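(* Fix an integer $d\ge1$. Let $\mathcal{L}$ be the oracle of a uniformly random $d$-Serial Simon's instance of size $n$ with target period $s=s_d$. Let $\mathcal{B}^{\mathcal{L}}$ be any $\mathrm{QC}_d$ circuit with oracle access to $\mathcal{L}$ (classical subroutines query $\mathcal{L}$ classically, quantum layers query it in superposition). Then $\Pr[s\leftarrow\mathcal{B}^{\mathcal{L}}]\le \mathrm{negl}(n)$.
   Context: A Simon function on $n$ bits is a pair $(f,s)$ with $s\in\{0,1\}^n\setminus\{0^n\}$ and $f:\{0,1\}^n\to\{0,1\}^n$ two-to-one such that $f(x)=f(y)\iff y\in\{x,x\oplus s\}$; uniformly random means uniform over all such pairs. The oracle of a function $F$ (possibly taking value $\perp$, encoded as a distinguished string) acts as $|x\rangle|a\rangle\mapsto|x\rangle|a\oplus F(x)\rangle$, and classical access returns $F(x)$. $d$-Serial Simon's instance: independent uniformly random Simon functions $(f_i,s_i)$, $i=0,\dots,d$; $L_0(x,z)=f_0(x)$; for $1\le i\le d$, $L_i(x,z)=f_i(x)$ if $z=s_{i-1}$ and $\perp$ otherwise; $\mathcal{L}$ is the oracle for $(L_0,\dots,L_d)$. Goal: output $s_d$. $\mathrm{QC}_d$ circuit with oracle $\mathcal{O}$: acts on $\mathrm{poly}(n)$ qubits and bits, starting from all zeros, and is specified by single-layer unitaries $U_1,\dots,U_d$ (products of one- and two-qubit gates on disjoint qubits, which may be classically controlled by the current classical data), polynomial-size classical circuits $\mathcal{A}_1,\dots,\mathcal{A}_{d+1}$ (randomised, with classical query access to $\mathcal{O}$),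 and computational-basis measurements $\Pi_1,\dots,\Pi_d$. It has the form $\mathcal{A}_{d+1}\circ\mathcal{B}_d\circ\cdots\circ\mathcal{B}_1$ with $\mathcal{B}_i=\Pi_i\circ\mathcal{O}\circ U_i\circ\mathcal{A}_i$: in step $i$ the classical circuit processes all classical data so far, then $U_i$ is applied, then the oracle is applied (polynomially many parallel queries allowed), then some qubits are measured in the computational basis and the outcomes passed to the next classical circuit; unmeasured qubits keep their coherence into the next step. $\mathcal{A}_{d+1}$ produces the output. A function is negligible if it is eventually smaller than $1/q(n)$ for every polynomial $q$. *)

theory Defs
  imports Complex_Main
begin

type_synonym bits = "bool list"

definition get :: "bits \<Rightarrow> nat \<Rightarrow> bool" where
  "get w i \<longleftrightarrow> i < length w \<and> w ! i"

definition bxor :: "bits \<Rightarrow> bits \<Rightarrow> bits" where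
  "bxor x y = map2 (\<noteq>) x y"

fun bin_nat :: "bits \<Rightarrow> nat" where
  "bin_nat [] = 0"
| "bin_nat (b # bs) = (if b then 1 else 0) + 2 * bin_nat bs"

text \<open>A Simon function on n bits: f is a function on n-bit strings (fixed to return the
  empty list outside its domain, so that f is determined by its values on the domain),
  s is a nonzero n-bit string, and f x = f y iff y is x or x xor s.\<close>
definition is_simon :: "nat \<Rightarrow> (bits \<Rightarrow> bits) \<Rightarrow> bits \<Rightarrow> bool" where
  "is_simon n f s \<longleftrightarrow>
     length s = n \<and> s \<noteq> replicate n False \<and>
     (\<forall>x. length x = n \<longrightarrow> length (f x) = n) \<and>
     (\<forall>x. length x \<noteq> n \<longrightarrow> f x = []) \<and>
     (\<forall>x y. length x = n \<longrightarrow> length y = n \<longrightarrow> (f x = f y \<longleftrightarrow> (y = x \<or> y = bxor x s)))"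

definition simon_instances :: "nat \<Rightarrow> nat \<Rightarrow> ((bits \<Rightarrow> bits) \<times> bits) list set" where
  "simon_instances n d =
     {I. length I = Suc d \<and> (\<forall>p\<in>set I. is_simon n (fst p) (snd p))}"

text \<open>Encoding of the joint oracle for (L_0,...,L_d): the input is
  (index i in binary, d+1 bits) @ x (n bits) @ z (n bits); the output is
  False # y for a value y and the distinguished string True # 0^n for bottom.\<close>
definition oracle_in_len :: "nat \<Rightarrow> nat \<Rightarrow> nat" where
  "oracle_in_len n d = Suc d + 2 * n"

definition oracle_out_len :: "nat \<Rightarrow> nat" where
  "oracle_out_len n = Suc n"

definition bot_str :: "nat \<Rightarrow> bits" where
  "bot_str n = True # replicate n False"

definition val_str :: "bits \<Rightarrow> bits" where
  "val_str y = False # y"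

definition serial_oracle :: "nat \<Rightarrow> nat \<Rightarrow> ((bits \<Rightarrow> bits) \<times> bits) list \<Rightarrow> bits \<Rightarrow> bits" where
  "serial_oracle n d I w =
     (if length w \<noteq> oracle_in_len n d then bot_str n
      else (let i = bin_nat (take (Suc d) w);
                x = take n (drop (Suc d) w);
                z = drop (Suc d + n) w
            in if i = 0 then val_str (fst (I ! 0) x)
               else if i \<le> d \<and> z = snd (I ! (i - 1)) then val_str (fst (I ! i) x)
               else bot_str n))"

datatype cgate = CConst bool | CNot nat | CAnd nat nat | COr nat nat | CQuery "nat list"

type_synonym ccirc = "cgate list \<times> nat list"  (* gates, output wires *)

fun cg_step :: "(bits \<Rightarrow> bits) \<Rightarrow> bits \<Rightarrow> cgate \<Rightarrow> bits" where
  "cg_step Orc ws (CConst b) = ws @ [b]"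
| "cg_step Orc ws (CNot i) = ws @ [\<not> get ws i]"
| "cg_step Orc ws (CAnd i j) = ws @ [get ws i \<and> get ws j]"
| "cg_step Orc ws (COr i j) = ws @ [get ws i \<or> get ws j]"
| "cg_step Orc ws (CQuery qs) = ws @ Orc (map (get ws) qs)"

definition ceval :: "(bits \<Rightarrow> bits) \<Rightarrow> ccirc \<Rightarrow> bits \<Rightarrow> bits" where
  "ceval Orc C inp = (let ws = foldl (cg_step Orc) inp (fst C) in map (get ws) (snd C))"

fun cg_size :: "cgate \<Rightarrow> nat" where
  "cg_size (CQuery qs) = Suc (length qs)"
| "cg_size _ = 1"

definition csize :: "ccirc \<Rightarrow> nat" where
  "csize C = sum_list (map cg_size (fst C)) + length (snd C)"

type_synonym qstate = "bits \<Rightarrow> complex"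

text \<open>One- and two-qubit gates, optionally classically controlled by a classical bit.\<close>
datatype qgate =
    G1 "nat option" nat "bool \<Rightarrow> bool \<Rightarrow> complex"
  | G2 "nat option" nat nat "bool \<times> bool \<Rightarrow> bool \<times> bool \<Rightarrow> complex"

definition unitary1 :: "(bool \<Rightarrow> bool \<Rightarrow> complex) \<Rightarrow> bool" where
  "unitary1 U \<longleftrightarrow> (\<forall>i j. (\<Sum>k\<in>UNIV. cnj (U k i) * U k j) = (if i = j then 1 else 0))"

definition unitary2 :: "(bool \<times> bool \<Rightarrow> bool \<times> bool \<Rightarrow> complex) \<Rightarrow> bool" where
  "unitary2 U \<longleftrightarrow> (\<forall>i j. (\<Sum>k\<in>UNIV. cnj (U k i) * U k j) = (if i = j then 1 else 0))"

definition apply1 :: "nat \<Rightarrow> (bool \<Rightarrow> bool \<Rightarrow> complex) \<Rightarrow> qstate \<Rightarrow> qstate" where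
  "apply1 q U \<psi> = (\<lambda>w. \<Sum>b\<in>UNIV. U (get w q) b * \<psi> (w[q := b]))"

definition apply2 :: "nat \<Rightarrow> nat \<Rightarrow> (bool \<times> bool \<Rightarrow> bool \<times> bool \<Rightarrow> complex) \<Rightarrow> qstate \<Rightarrow> qstate" where
  "apply2 q1 q2 U \<psi> =
     (\<lambda>w. \<Sum>p\<in>UNIV. U (get w q1, get w q2) p * \<psi> (w[q1 := fst p, q2 := snd p]))"

definition ctrl_on :: "bits \<Rightarrow> nat option \<Rightarrow> bool" where
  "ctrl_on cm c = (case c of None \<Rightarrow> True | Some j \<Rightarrow> get cm j)"

fun apply_gate :: "bits \<Rightarrow> qgate \<Rightarrow> qstate \<Rightarrow> qstate" where
  "apply_gate cm (G1 c q U) \<psi> = (if ctrl_on cm c then apply1 q U \<psi> else \<psi>)"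
| "apply_gate cm (G2 c q1 q2 U) \<psi> = (if ctrl_on cm c then apply2 q1 q2 U \<psi> else \<psi>)"

definition apply_layer :: "bits \<Rightarrow> qgate list \<Rightarrow> qstate \<Rightarrow> qstate" where
  "apply_layer cm gs \<psi> = foldr (apply_gate cm) gs \<psi>"

fun gate_qubits :: "qgate \<Rightarrow> nat list" where
  "gate_qubits (G1 c q U) = [q]"
| "gate_qubits (G2 c q1 q2 U) = [q1, q2]"

fun gate_ok :: "qgate \<Rightarrow> bool" where
  "gate_ok (G1 c q U) = unitary1 U"
| "gate_ok (G2 c q1 q2 U) = unitary2 U"

definition layer_ok :: "nat \<Rightarrow> qgate list \<Rightarrow> bool" where
  "layer_ok m gs \<longleftrightarrow> (\<forall>g\<in>set gs. gate_ok g) \<and>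
     distinct (concat (map gate_qubits gs)) \<and> (\<forall>q\<in>set (concat (map gate_qubits gs)). q < m)"

definition sel :: "bits \<Rightarrow> nat list \<Rightarrow> bits" where
  "sel w qs = map (get w) qs"

fun upd_bits :: "bits \<Rightarrow> nat list \<Rightarrow> bits \<Rightarrow> bits" where
  "upd_bits w [] v = w"
| "upd_bits w (i # qs) v = (case v of [] \<Rightarrow> w | b # bs \<Rightarrow> upd_bits (w[i := b]) qs bs)"

text \<open>Quantum query |x>|a> -> |x>|a xor F(x)> on the registers (xs, as).\<close>
definition apply_query :: "(bits \<Rightarrow> bits) \<Rightarrow> nat list \<times> nat list \<Rightarrow> qstate \<Rightarrow> qstate" where
  "apply_query F S \<psi> =
     (\<lambda>w. \<psi> (upd_bits w (snd S) (bxor (sel w (snd S)) (F (sel w (fst S))))))"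

definition apply_queries :: "(bits \<Rightarrow> bits) \<Rightarrow> (nat list \<times> nat list) list \<Rightarrow> qstate \<Rightarrow> qstate" where
  "apply_queries F Ss \<psi> = foldr (apply_query F) Ss \<psi>"

definition slots_ok :: "nat \<Rightarrow> nat \<Rightarrow> nat \<Rightarrow> (nat list \<times> nat list) list \<Rightarrow> bool" where
  "slots_ok n d m Ss \<longleftrightarrow>
     (\<forall>S\<in>set Ss. length (fst S) = oracle_in_len n d \<and> length (snd S) = oracle_out_len n) \<and>
     distinct (concat (map (\<lambda>S. fst S @ snd S) Ss)) \<and>
     (\<forall>q\<in>set (concat (map (\<lambda>S. fst S @ snd S) Ss)). q < m)"

definition project :: "nat list \<Rightarrow> bits \<Rightarrow> qstate \<Rightarrow> qstate" where
  "project M ob \<psi> = (\<lambda>w. if sel w M = ob then \<psi> w else 0)"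

definition sqnorm :: "nat \<Rightarrow> qstate \<Rightarrow> real" where
  "sqnorm m \<psi> = (\<Sum>w\<in>{w. length w = m}. (cmod (\<psi> w))\<^sup>2)"

definition zero_state :: "nat \<Rightarrow> qstate" where
  "zero_state m = (\<lambda>w. if w = replicate m False then 1 else 0)"

record qcstep =
  cc :: ccirc
  layer :: "qgate list"
  qslots :: "(nat list \<times> nat list) list"
  meas :: "nat list"

record qccirc =
  nq :: nat
  nrand :: nat
  steps :: "qcstep list"
  final :: ccirc

definition step_ok :: "nat \<Rightarrow> nat \<Rightarrow> nat \<Rightarrow> qcstep \<Rightarrow> bool" where
  "step_ok n d m st \<longleftrightarrow> layer_ok m (layer st) \<and> slots_ok n d m (qslots st) \<and>
     distinct (meas st) \<and> (\<forall>q\<in>set (meas st). q < m)"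

text \<open>Success weight: sum over all measurement branches of the squared norm of the
  unnormalised branch state, counting branches whose final output equals tgt.\<close>
fun exec :: "(bits \<Rightarrow> bits) \<Rightarrow> nat \<Rightarrow> bits \<Rightarrow> qcstep list \<Rightarrow> ccirc \<Rightarrow> bits \<Rightarrow> qstate \<Rightarrow> real" where
  "exec Orc m tgt [] Af cm \<psi> = (if ceval Orc Af cm = tgt then sqnorm m \<psi> else 0)"
| "exec Orc m tgt (st # sts) Af cm \<psi> =
     (let cm1 = ceval Orc (cc st) cm;
          \<psi>1 = apply_queries Orc (qslots st) (apply_layer cm1 (layer st) \<psi>)
      in \<Sum>ob\<in>{ob. length ob = length (meas st)}. exec Orc m tgt sts Af (cm1 @ ob) (project (meas st) ob \<psi>1))"

definition success_prob :: "nat \<Rightarrow> nat \<Rightarrow> 'a qccirc_scheme \<Rightarrow> real" where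
  "success_prob n d C =
     (\<Sum>I\<in>simon_instances n d. \<Sum>r\<in>{r. length r = nrand C}.
        exec (serial_oracle n d I) (nq C) (snd (I ! d)) (steps C) (final C) r (zero_state (nq C)))
     / (real (card (simon_instances n d)) * 2 ^ nrand C)"

definition is_QC :: "nat \<Rightarrow> (nat \<Rightarrow> qccirc) \<Rightarrow> bool" where
  "is_QC d C \<longleftrightarrow> (\<exists>c::nat. \<forall>n.
     length (steps (C n)) = d \<and>
     (\<forall>st\<in>set (steps (C n)). step_ok n d (nq (C n)) st \<and> csize (cc st) \<le> c * Suc n ^ c) \<and>
     csize (final (C n)) \<le> c * Suc n ^ c \<and>
     nq (C n) \<le> c * Suc n ^ c \<and> nrand (C n) \<le> c * Suc n ^ c)"

definition negligible :: "(nat \<Rightarrow> real) \<Rightarrow> bool" where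
  "negligible \<epsilon> \<longleftrightarrow> (\<forall>k::nat. \<forall>\<^sub>F n in sequentially. \<epsilon> n < 1 / real n ^ k)"

end

theory Submission
  imports Defs "HOL-Combinatorics.Permutations"
begin

text \<open>Run step \<open>k\<close> (counted from 0) with the oracle that answers bottom on all levels above \<open>k\<close>. Before
  the quantum query of step \<open>k\<close>, such a run has met the components \<open>t \<ge> k\<close> of the instance only
  through the classical queries of that step to \<open>f\<^sub>k\<close>, and a few classical queries to a random
  Simon function look like queries to a random permutation, which is independent of the period.
  So the total query weight on points with \<open>z = s\<^sub>t\<close>, \<open>t \<ge> k\<close>, is exponentially small on average, and
  restoring the true oracle from the last step back to the first changes the success weight
  accordingly: the success weight is a positive quadratic form \<open>E\<close> in the state, so
  \<open>E (\<phi> + \<delta>) \<le> 2 E \<phi> + 2 E \<delta>\<close>, and the factor \<open>2\<close> per step is harmless for constant \<open>d\<close>. In the fully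
  truncated run the final classical circuit has only classical access to \<open>f\<^sub>d\<close>.\<close>

subsection \<open>Random Simon functions\<close>

lemma finite_bits [simp]: "finite {x :: bits. length x = n}"
  using finite_lists_length_eq[of "UNIV :: bool set" n] by simp

lemma card_bits: "card {x :: bits. length x = n} = 2 ^ n"
  using card_lists_length_eq[of "UNIV :: bool set" n] by simp

lemma length_bxor [simp]: "length (bxor x y) = min (length x) (length y)"
  by (simp add: bxor_def)

lemma nth_bxor: "i < length x \<Longrightarrow> i < length y \<Longrightarrow> bxor x y ! i = (x ! i \<noteq> y ! i)"
  by (simp add: bxor_def)

lemma bxor_bxor_cancel: "length x = length s \<Longrightarrow> bxor (bxor x s) s = x"
  by (auto intro!: nth_equalityI simp: nth_bxor)

lemma nonzero_bit:
  assumes "length s = n" "s \<noteq> replicate n False"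
  shows "\<exists>j<n. s ! j"
  using assms by (auto simp: list_eq_iff_nth_eq)

lemma sum_bool_indicator: "finite A \<Longrightarrow> (\<Sum>x\<in>A. if P x then c else 0) = real (card {x \<in> A. P x}) * c"
  by (simp add: sum.If_cases Int_def)

text \<open>The complements of \<open>R\<close> and of its image have the same finite size, so any
  bijection between them completes \<open>f\<close>.\<close>

lemma inj_on_extends_to_permutation:
  assumes "finite A" "R \<subseteq> A" "inj_on f R" "f ` R \<subseteq> A"
  shows "\<exists>g. g permutes A \<and> (\<forall>x\<in>R. g x = f x)"
proof -
  have "card (A - R) = card (A - f ` R)"
    using assms by (simp add: card_Diff_subset finite_subset card_image)
  then obtain e where e: "bij_betw e (A - R) (A - f ` R)"
    using finite_same_card_bij assms(1) by blast
  define g where "g x = (if x \<in> R then f x else if x \<in> A then e x else x)" for x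
  have "bij_betw g R (f ` R)"
    using assms(3) by (auto simp: bij_betw_def g_def inj_on_def)
  moreover have "bij_betw g (A - R) (A - f ` R)"
    using e by (subst bij_betw_cong[where g = e]) (auto simp: g_def)
  ultimately have "bij_betw g (R \<union> (A - R)) (f ` R \<union> (A - f ` R))"
    by (intro bij_betw_combine) auto
  then have "bij_betw g A A"
    using assms by (simp add: Un_absorb1)
  then have "g permutes A"
    using assms(2) by (intro bij_imp_permutes) (auto simp: g_def)
  then show ?thesis by (auto simp: g_def)
qed

text \<open>With \<open>s ! j\<close> set, \<open>coset_rep j s\<close> picks the element of \<open>{x, x \<oplus> s}\<close> whose bit \<open>j\<close> is clear.\<close>
definition coset_rep :: "nat \<Rightarrow> bits \<Rightarrow> bits \<Rightarrow> bits" where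
  "coset_rep j s x = (if x ! j then bxor x s else x)"

text \<open>When \<open>s ! j\<close> holds, only the values of \<open>h\<close> on strings with bit
  \<open>j\<close> clear are consulted. One permutation thus yields a Simon function for every
  period, which separates the randomness of the function from that of the period.\<close>

definition simon_of_perm :: "nat \<Rightarrow> nat \<Rightarrow> bits \<Rightarrow> (bits \<Rightarrow> bits) \<Rightarrow> bits \<Rightarrow> bits" where
  "simon_of_perm n j s h x = (if length x = n then h (coset_rep j s x) else [])"

lemma coset_rep_length: "length x = n \<Longrightarrow> length s = n \<Longrightarrow> length (coset_rep j s x) = n"
  by (simp add: coset_rep_def)

lemma coset_rep_bit:
  "length x = n \<Longrightarrow> length s = n \<Longrightarrow> j < n \<Longrightarrow> s ! j \<Longrightarrow> \<not> coset_rep j s x ! j"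
  by (auto simp: coset_rep_def nth_bxor)

lemma coset_rep_eq_iff:
  assumes "length s = n" "j < n" "s ! j" "length x = n" "length y = n"
  shows "coset_rep j s x = coset_rep j s y \<longleftrightarrow> y = x \<or> y = bxor x s"
proof -
  have "bxor x s ! j \<longleftrightarrow> \<not> x ! j" "bxor y s ! j \<longleftrightarrow> \<not> y ! j"
    using assms by (auto simp: nth_bxor)
  moreover have "bxor (bxor x s) s = x" "bxor (bxor y s) s = y"
    using assms by (auto intro: bxor_bxor_cancel)
  ultimately show ?thesis
    unfolding coset_rep_def by metis
qed

lemma simon_of_perm_is_simon:
  assumes "h permutes {x. length x = n}" "length s = n" "j < n" "s ! j"
  shows "is_simon n (simon_of_perm n j s h) s"
proof -
  have "length (h x) = n" if "length x = n" for x
    using permutes_in_image[OF assms(1), of x] that by simp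
  moreover have "s \<noteq> replicate n False"
    using assms by (metis nth_replicate)
  moreover have "h x = h y \<longleftrightarrow> x = y" for x y
    using permutes_inj[OF assms(1)] by (auto dest: injD)
  ultimately show ?thesis
    using assms by (simp add: is_simon_def simon_of_perm_def coset_rep_length coset_rep_eq_iff)
qed

text \<open>The fibre is a coset of a symmetric group: \<open>h\<close> is forced to equal
  \<open>f\<close> on the representatives \<open>R\<close> and is free on the other
  \<open>2 ^ (n - 1)\<close> strings. As its size does not depend on \<open>f\<close>, a uniform
  permutation gives a uniform Simon function of period \<open>s\<close>.\<close>

lemma simon_of_perm_fibre:
  assumes f: "is_simon n f s" and j: "j < n" "s ! j"
  shows "card {h. h permutes {x. length x = n} \<and> simon_of_perm n j s h = f} = fact (2 ^ (n - 1))"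
proof -
  let ?D = "{x :: bits. length x = n}"
  define R where "R = {x \<in> ?D. \<not> x ! j}"
  have s: "length s = n" using f by (simp add: is_simon_def)
  have fD: "\<And>x. length x = n \<Longrightarrow> length (f x) = n" and fout: "\<And>x. length x \<noteq> n \<Longrightarrow> f x = []"
    and feq: "\<And>x y. length x = n \<Longrightarrow> length y = n \<Longrightarrow> (f x = f y \<longleftrightarrow> y = x \<or> y = bxor x s)"
    using f by (auto simp: is_simon_def)
  have bit: "bxor x s ! j \<longleftrightarrow> \<not> x ! j" if "length x = n" for x
    using that s j by (simp add: nth_bxor)
  have "inj_on f R"
    using feq bit by (auto simp: inj_on_def R_def)
  then obtain g where g: "g permutes ?D" "\<And>x. x \<in> R \<Longrightarrow> g x = f x"
    using inj_on_extends_to_permutation[of ?D R f] fD by (auto simp: R_def)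
  have frep: "f (coset_rep j s x) = f x" if "length x = n" for x
    using feq[of x "coset_rep j s x"] that s by (auto simp: coset_rep_def)
  have repR: "coset_rep j s x \<in> R" if "length x = n" for x
    using that s j coset_rep_bit coset_rep_length by (auto simp: R_def)
  have Rrep: "coset_rep j s x = x" if "x \<in> R" for x
    using that by (simp add: R_def coset_rep_def)
  have eq: "simon_of_perm n j s h = f \<longleftrightarrow> (\<forall>x\<in>R. h x = f x)" for h
  proof
    assume H: "simon_of_perm n j s h = f"
    show "\<forall>x\<in>R. h x = f x"
      using Rrep by (auto simp: H[symmetric] simon_of_perm_def R_def)
  next
    assume "\<forall>x\<in>R. h x = f x"
    then show "simon_of_perm n j s h = f"
      using repR frep fout by (auto simp: simon_of_perm_def fun_eq_iff)
  qed
  have "{h. h permutes ?D \<and> simon_of_perm n j s h = f} = (\<lambda>k. g \<circ> k) ` {k. k permutes (?D - R)}"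
  proof (intro equalityI subsetI)
    fix h assume "h \<in> {h. h permutes ?D \<and> simon_of_perm n j s h = f}"
    then have h: "h permutes ?D" "\<forall>x\<in>R. h x = g x" by (auto simp: eq g)
    have k: "(inv g \<circ> h) permutes ?D"
      using h g permutes_compose permutes_inv by blast
    have "(inv g \<circ> h) x = x" if "x \<notin> ?D - R" for x
      using that h k permutes_inverses(2)[OF g(1)] permutes_not_in[OF k] by (cases "x \<in> R") auto
    then have "(inv g \<circ> h) permutes (?D - R)"
      using permutes_superset[OF k, of "?D - R"] by (metis permutes_subset Diff_iff)
    moreover have "h = g \<circ> (inv g \<circ> h)"
      using permutes_inverses(1)[OF g(1)] by (auto simp: fun_eq_iff)
    ultimately show "h \<in> (\<lambda>k. g \<circ> k) ` {k. k permutes (?D - R)}" by blast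
  next
    fix h assume "h \<in> (\<lambda>k. g \<circ> k) ` {k. k permutes (?D - R)}"
    then obtain k where k: "k permutes (?D - R)" "h = g \<circ> k" by auto
    have "k permutes ?D" using k(1) by (rule permutes_subset) auto
    then have "h permutes ?D" using k g(1) permutes_compose by blast
    moreover have "\<forall>x\<in>R. h x = f x"
      using k g permutes_not_in[OF k(1)] by auto
    ultimately show "h \<in> {h. h permutes ?D \<and> simon_of_perm n j s h = f}" by (simp add: eq)
  qed
  moreover have "inj_on (\<lambda>k. g \<circ> k) {k. k permutes (?D - R)}"
    using permutes_inj[OF g(1)] by (auto simp: inj_on_def fun_eq_iff dest: injD)
  moreover have "card (?D - R) = 2 ^ (n - 1)"
  proof -
    have sub: "R \<subseteq> ?D" by (auto simp: R_def)
    have "card (?D - R) = card R"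
      by (rule bij_betw_same_card[of "\<lambda>x. bxor x s"], rule bij_betw_byWitness[of _ "\<lambda>x. bxor x s"])
        (use s bit in \<open>auto simp: R_def bxor_bxor_cancel\<close>)
    moreover have "card (?D - R) + card R = 2 ^ n"
      using card_Diff_subset[OF finite_subset[OF sub finite_bits] sub] card_mono[OF finite_bits sub]
      by (simp add: card_bits)
    moreover have "(2::nat) ^ n = 2 * 2 ^ (n - 1)"
      using j by (simp flip: power_Suc)
    ultimately show ?thesis by simp
  qed
  ultimately show ?thesis
    by (simp add: card_image card_permutations)
qed

definition simon_pairs :: "nat \<Rightarrow> ((bits \<Rightarrow> bits) \<times> bits) set" where
  "simon_pairs n = {p. is_simon n (fst p) (snd p)}"

lemma sum_simon_of_perm:
  assumes "length s = n" "j < n" "s ! j"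
  shows "(\<Sum>h | h permutes {x. length x = n}. F (simon_of_perm n j s h))
       = fact (2 ^ (n - 1)) * (\<Sum>f | is_simon n f s. F f :: real)"
    and "finite {f. is_simon n f s}"
proof -
  let ?P = "{h. h permutes {x :: bits. length x = n}}"
  have fP: "finite ?P" by (simp add: finite_permutations)
  have img: "simon_of_perm n j s ` ?P = {f. is_simon n f s}"
  proof (intro equalityI subsetI)
    fix f assume f: "f \<in> {f. is_simon n f s}"
    \<comment> \<open>Surjectivity comes from counting: an empty fibre would have size 0, which is
      no factorial.\<close>
    have "{h. h permutes {x. length x = n} \<and> simon_of_perm n j s h = f} \<noteq> {}"
      using simon_of_perm_fibre[of n f s j] f assms by (metis card.empty fact_nonzero mem_Collect_eq)
    then show "f \<in> simon_of_perm n j s ` ?P" by auto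
  qed (use assms simon_of_perm_is_simon in auto)
  show fin: "finite {f. is_simon n f s}"
    using fP unfolding img[symmetric] by (rule finite_imageI)
  have "(\<Sum>h\<in>?P. F (simon_of_perm n j s h))
      = (\<Sum>f | is_simon n f s. \<Sum>h\<in>{h \<in> ?P. simon_of_perm n j s h = f}. F (simon_of_perm n j s h))"
    using fP fin img by (intro sum.group[symmetric]) auto
  also have "\<dots> = (\<Sum>f | is_simon n f s. fact (2 ^ (n - 1)) * F f)"
    using simon_of_perm_fibre[of n _ s j] assms by (intro sum.cong) auto
  finally show "(\<Sum>h\<in>?P. F (simon_of_perm n j s h))
       = fact (2 ^ (n - 1)) * (\<Sum>f | is_simon n f s. F f)"
    by (simp add: sum_distrib_left)
qed

text \<open>Composing with \<open>coset_swap\<close> trades a permutation for one whose Simon function has the same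
  values on \<open>Q\<close>, as long as \<open>s\<close> is not a difference of two elements of \<open>Q\<close>.\<close>
definition coset_swap :: "nat \<Rightarrow> nat \<Rightarrow> bits \<Rightarrow> bits set \<Rightarrow> bits \<Rightarrow> bits" where
  "coset_swap n j s Q x =
     (if length x = n \<and> ((x \<in> Q \<and> x ! j) \<or> (bxor x s \<in> Q \<and> bxor x s ! j)) then bxor x s else x)"

lemma coset_swap_involution: "length s = n \<Longrightarrow> coset_swap n j s Q (coset_swap n j s Q x) = x"
  by (auto simp: coset_swap_def bxor_bxor_cancel)

lemma coset_swap_permutes:
  assumes "length s = n"
  shows "coset_swap n j s Q permutes {x. length x = n}"
proof (rule bij_imp_permutes)
  show "bij_betw (coset_swap n j s Q) {x. length x = n} {x. length x = n}"
    by (rule bij_betw_byWitness[of _ "coset_swap n j s Q"])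
      (use assms in \<open>auto simp: coset_swap_involution\<close>, auto simp: coset_swap_def)
qed (auto simp: coset_swap_def)

text \<open>\<open>Q f\<close> plays the set of points at which an algorithm queries \<open>f\<close>, and \<open>w f s\<close> a payoff that
  depends on \<open>f\<close> through these queries only. Unless \<open>s\<close> is a difference of two queries, a random
  Simon function looks like a random permutation, which carries no information about \<open>s\<close>.\<close>
lemma simon_period_hidden:
  fixes w :: "(bits \<Rightarrow> bits) \<Rightarrow> bits \<Rightarrow> real"
  assumes loc: "\<And>f f'. (\<And>x. x \<in> Q f \<Longrightarrow> f' x = f x) \<Longrightarrow> Q f' = Q f \<and> w f' = w f"
    and Q: "\<And>f. Q f \<subseteq> {x. length x = n}" "\<And>f. card (Q f) \<le> q"
    and w: "\<And>f s. 0 \<le> w f s" "\<And>f s. w f s \<le> W"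
    and K: "\<And>f. (\<Sum>s | length s = n. w f s) \<le> K"
  shows "(2 ^ n - 1) * (\<Sum>p\<in>simon_pairs n. w (fst p) (snd p)) \<le> real (card (simon_pairs n)) * (K + real q ^ 2 * W)"
    and "finite (simon_pairs n)"
proof -
  let ?D = "{x :: bits. length x = n}"
  let ?P = "{h. h permutes ?D}"
  define S where "S = ?D - {replicate n False}"
  define M :: real where "M = fact (2 ^ (n - 1))"
  have M: "M > 0" by (simp add: M_def)
  have finS: "finite S" by (simp add: S_def)
  have cardS: "real (card S) = 2 ^ n - 1"
    by (simp add: S_def card_bits)
  have fP: "finite ?P" by (simp add: finite_permutations)
  have "\<exists>j<n. s ! j" if "s \<in> S" for s
    using that nonzero_bit by (auto simp: S_def)
  then obtain J where J: "\<And>s. s \<in> S \<Longrightarrow> J s < n" "\<And>s. s \<in> S \<Longrightarrow> s ! J s" by metis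
  have lS: "length s = n" if "s \<in> S" for s using that by (simp add: S_def)
  have W: "0 \<le> W" using w[of undefined undefined] by linarith
  define good where "good s f \<longleftrightarrow> (\<forall>x\<in>Q f. bxor x s \<notin> Q f)" for s f
  define sp where "sp s = simon_of_perm n (J s) s" for s
  have finSim: "finite {f. is_simon n f s}" if "s \<in> S" for s
    using sum_simon_of_perm(2) J[OF that] lS[OF that] by blast
  have pairs: "simon_pairs n = (\<lambda>(s, f). (f, s)) ` Sigma S (\<lambda>s. {f. is_simon n f s})"
    by (auto simp: simon_pairs_def image_def S_def is_simon_def)
  show fin: "finite (simon_pairs n)"
    unfolding pairs using finS finSim by (intro finite_imageI finite_SigmaI)
  \<comment> \<open>Up to the common fibre size \<open>M\<close>, a random pair is a random period
    with an independent random permutation.\<close>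
  have sum_pairs: "M * (\<Sum>p\<in>simon_pairs n. F (fst p) (snd p)) = (\<Sum>s\<in>S. \<Sum>h\<in>?P. F (sp s h) s)" for F
  proof -
    have "(\<Sum>p\<in>simon_pairs n. F (fst p) (snd p))
        = (\<Sum>(s, f)\<in>Sigma S (\<lambda>s. {f. is_simon n f s}). F f s)"
      unfolding pairs by (subst sum.reindex) (auto simp: inj_on_def case_prod_beta)
    also have "\<dots> = (\<Sum>s\<in>S. \<Sum>f | is_simon n f s. F f s)"
      using finS finSim by (subst sum.Sigma) auto
    finally have "M * (\<Sum>p\<in>simon_pairs n. F (fst p) (snd p)) = (\<Sum>s\<in>S. M * (\<Sum>f | is_simon n f s. F f s))"
      by (simp add: sum_distrib_left)
    also have "\<dots> = (\<Sum>s\<in>S. \<Sum>h\<in>?P. F (sp s h) s)"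
    proof (rule sum.cong[OF refl])
      fix s assume s: "s \<in> S"
      show "M * (\<Sum>f | is_simon n f s. F f s) = (\<Sum>h\<in>?P. F (sp s h) s)"
        using sum_simon_of_perm(1)[OF lS[OF s] J[OF s], of "\<lambda>f. F f s"] by (simp add: M_def sp_def)
    qed
    finally show ?thesis .
  qed
  have card_pairs: "M * real (card (simon_pairs n)) = (2 ^ n - 1) * real (card ?P)"
    using sum_pairs[of "\<lambda>_ _. 1"] by (simp add: cardS)
  \<comment> \<open>For fixed \<open>s\<close>, composing with the swap matches permutations queried
    directly with permutations queried through their Simon function, keeping the transcript.
    \<open>F\<close> is later the constant 1, to compare counts, and the identity, to compare
    payoffs.\<close>
  have swap: "(\<Sum>g\<in>{g \<in> ?P. good s g}. F (w g s)) = (\<Sum>h\<in>{h \<in> ?P. good s (sp s h)}. F (w (sp s h) s))"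
    if s: "s \<in> S" for s and F :: "real \<Rightarrow> real"
  proof -
    let ?sw = "\<lambda>f. coset_swap n (J s) s (Q f)"
    note js = J[OF s] lS[OF s]
    have perm: "g \<circ> ?sw f \<in> ?P" if "g \<in> ?P" for g f
      using that permutes_compose[OF coset_swap_permutes[OF js(3)]] by auto
    have canc: "g \<circ> ?sw f \<circ> ?sw f = g" for g :: "bits \<Rightarrow> bits" and f
      by (simp add: fun_eq_iff coset_swap_involution js)
    \<comment> \<open>If bit \<open>J s\<close> of the query \<open>x\<close> is set, its
      representative is \<open>bxor x s\<close>, which the swap sends back to \<open>x\<close>; if
      it is clear, goodness keeps the swap from moving \<open>x\<close>.\<close>
    have agree1: "sp s (g \<circ> ?sw g) x = g x" if "good s g" "x \<in> Q g" for g x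
    proof -
      have x: "length x = n" "bxor x s \<notin> Q g" using that Q by (auto simp: good_def)
      show ?thesis
        using that x js by (auto simp: sp_def simon_of_perm_def coset_rep_def coset_swap_def bxor_bxor_cancel)
    qed
    have agree2: "(h \<circ> ?sw (sp s h)) x = sp s h x" if "good s (sp s h)" "x \<in> Q (sp s h)" for h x
    proof -
      have x: "length x = n" "bxor x s \<notin> Q (sp s h)" using that Q by (auto simp: good_def)
      show ?thesis
        using that(2) x js by (auto simp: sp_def simon_of_perm_def coset_rep_def coset_swap_def)
    qed
    note l1 = loc[of g "sp s (g \<circ> ?sw g)" for g, OF agree1]
    note l2 = loc[of "sp s h" "h \<circ> ?sw (sp s h)" for h, OF agree2]
    show ?thesis
    proof (rule sum.reindex_bij_witness[of _ "\<lambda>h. h \<circ> ?sw (sp s h)" "\<lambda>g. g \<circ> ?sw g"])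
      fix g assume g: "g \<in> {g \<in> ?P. good s g}"
      then have l: "Q (sp s (g \<circ> ?sw g)) = Q g" "w (sp s (g \<circ> ?sw g)) = w g" using l1 by auto
      show "g \<circ> ?sw g \<circ> ?sw (sp s (g \<circ> ?sw g)) = g" by (simp only: l canc)
      show "g \<circ> ?sw g \<in> {h \<in> ?P. good s (sp s h)}"
        using g perm[of g g] l by (auto simp: good_def)
      show "F (w (sp s (g \<circ> ?sw g)) s) = F (w g s)" by (simp add: l)
    next
      fix h assume h: "h \<in> {h \<in> ?P. good s (sp s h)}"
      then have l: "Q (h \<circ> ?sw (sp s h)) = Q (sp s h)" using l2 by auto
      show "h \<circ> ?sw (sp s h) \<circ> ?sw (h \<circ> ?sw (sp s h)) = h" by (simp only: l canc)
      show "h \<circ> ?sw (sp s h) \<in> {g \<in> ?P. good s g}"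
        using h perm[of h "sp s h"] l by (auto simp: good_def)
    qed
  qed
  \<comment> \<open>Good permutations are matched with equal payoff. The bad ones are therefore
    equally many on both sides, and each costs at most \<open>W\<close>.\<close>
  have per_s: "(\<Sum>h\<in>?P. w (sp s h) s) \<le> (\<Sum>g\<in>?P. w g s + (if \<not> good s g then W else 0))" if s: "s \<in> S" for s
  proof -
    have split: "sum F ?P = sum F {h \<in> ?P. R h} + sum F {h \<in> ?P. \<not> R h}" for F :: "_ \<Rightarrow> real" and R
      by (subst sum.union_disjoint[symmetric]) (use fP in \<open>auto intro!: sum.cong\<close>)
    have cg: "real (card {g \<in> ?P. good s g}) = real (card {h \<in> ?P. good s (sp s h)})"
      using swap[OF s, of "\<lambda>_. 1"] by simp
    then have cb: "real (card {g \<in> ?P. \<not> good s g}) = real (card {h \<in> ?P. \<not> good s (sp s h)})"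
      using split[of "\<lambda>_. 1" "good s"] split[of "\<lambda>_. 1" "\<lambda>h. good s (sp s h)"] by simp
    have "(\<Sum>h\<in>?P. w (sp s h) s)
        = (\<Sum>h\<in>{h \<in> ?P. good s (sp s h)}. w (sp s h) s) + (\<Sum>h\<in>{h \<in> ?P. \<not> good s (sp s h)}. w (sp s h) s)"
      by (rule split)
    also have "\<dots> \<le> (\<Sum>g\<in>{g \<in> ?P. good s g}. w g s) + real (card {g \<in> ?P. \<not> good s g}) * W"
      unfolding cb using swap[OF s, of "\<lambda>x. x"] w by (simp add: sum_bounded_above)
    also have "\<dots> \<le> (\<Sum>g\<in>?P. w g s) + real (card {g \<in> ?P. \<not> good s g}) * W"
      using split[of "\<lambda>g. w g s" "good s"] w by (simp add: sum_nonneg)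
    also have "\<dots> = (\<Sum>g\<in>?P. w g s + (if \<not> good s g then W else 0))"
      using sum_bool_indicator[OF fP] by (simp add: sum.distrib)
    finally show ?thesis .
  qed
  \<comment> \<open>Now the permutation is fixed and the period varies: the payoffs add up to at
    most \<open>K\<close>, and a bad period is the xor of two queries, so there are at most
    \<open>q ^ 2\<close> of them.\<close>
  have per_g: "(\<Sum>s\<in>S. w g s + (if \<not> good s g then W else 0)) \<le> K + real q ^ 2 * W" for g
  proof -
    have fQ: "finite (Q g)" using Q(1) finite_bits finite_subset by blast
    have "{s \<in> S. \<not> good s g} \<subseteq> (\<lambda>(x, y). bxor y x) ` (Q g \<times> Q g)"
    proof
      fix s assume "s \<in> {s \<in> S. \<not> good s g}"
      then obtain x where x: "x \<in> Q g" "bxor x s \<in> Q g" "length s = n" by (auto simp: good_def S_def)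
      then have "length x = n" using Q by auto
      then have "s = bxor (bxor x s) x"
        using x(3) by (auto intro!: nth_equalityI simp: nth_bxor)
      then show "s \<in> (\<lambda>(x, y). bxor y x) ` (Q g \<times> Q g)" using x by force
    qed
    then have "card {s \<in> S. \<not> good s g} \<le> card ((\<lambda>(x, y). bxor y x) ` (Q g \<times> Q g))"
      using fQ by (intro card_mono) auto
    also have "\<dots> \<le> card (Q g) * card (Q g)"
      using card_image_le[of "Q g \<times> Q g"] fQ by (simp add: card_cartesian_product)
    also have "\<dots> \<le> q ^ 2"
      using Q(2)[of g] by (simp add: power2_eq_square mult_le_mono)
    finally have "real (card {s \<in> S. \<not> good s g}) \<le> real q ^ 2"
      by (metis of_nat_le_iff of_nat_power)
    then have "(\<Sum>s\<in>S. if \<not> good s g then W else 0) \<le> real q ^ 2 * W"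
      using W by (simp add: sum_bool_indicator[OF finS] mult_right_mono)
    moreover have "(\<Sum>s\<in>S. w g s) \<le> K"
      using K[of g] sum_mono2[of ?D S "w g"] w by (fastforce simp: S_def)
    ultimately show ?thesis unfolding sum.distrib by linarith
  qed
  have "M * (\<Sum>p\<in>simon_pairs n. w (fst p) (snd p)) \<le> (\<Sum>s\<in>S. \<Sum>g\<in>?P. w g s + (if \<not> good s g then W else 0))"
    unfolding sum_pairs by (intro sum_mono per_s)
  also have "\<dots> \<le> real (card ?P) * (K + real q ^ 2 * W)"
    by (subst sum.swap) (rule sum_bounded_above[OF per_g])
  finally have "(2 ^ n - 1) * (M * (\<Sum>p\<in>simon_pairs n. w (fst p) (snd p)))
      \<le> (2 ^ n - 1) * (real (card ?P) * (K + real q ^ 2 * W))"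
    by (intro mult_left_mono) auto
  \<comment> \<open>By \<open>card_pairs\<close>, \<open>2 ^ n - 1\<close> times the number of
    permutations is \<open>M\<close> times the number of pairs, so that \<open>M\<close>
    cancels.\<close>
  also have "\<dots> = M * (real (card (simon_pairs n)) * (K + real q ^ 2 * W))"
    using card_pairs by (metis mult.assoc)
  finally have "M * ((2 ^ n - 1) * (\<Sum>p\<in>simon_pairs n. w (fst p) (snd p))) \<le> M * (real (card (simon_pairs n)) * (K + real q ^ 2 * W))"
    by (simp add: mult_ac)
  then show "(2 ^ n - 1) * (\<Sum>p\<in>simon_pairs n. w (fst p) (snd p)) \<le> real (card (simon_pairs n)) * (K + real q ^ 2 * W)"
    using M by simp
qed

section \<open>Independence of the components of an instance\<close>

text \<open>Exchanging component \<open>t\<close> with the fresh pair is an involution on instances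
  times pairs, so resampling one component keeps the distribution uniform.\<close>

lemma sum_simon_instances_resample:
  fixes F :: "((bits \<Rightarrow> bits) \<times> bits) list \<Rightarrow> real"
  assumes "t \<le> d"
  shows "(\<Sum>I\<in>simon_instances n d. \<Sum>p\<in>simon_pairs n. F (I[t := p]))
       = real (card (simon_pairs n)) * (\<Sum>I\<in>simon_instances n d. F I)"
proof -
  let ?X = "simon_instances n d \<times> simon_pairs n"
  have mem: "(I[t := p], I ! t) \<in> ?X" if "(I, p) \<in> ?X" for I p
    using that assms set_update_subset_insert[of I t p]
    by (force simp: simon_instances_def simon_pairs_def)
  have "(\<Sum>I\<in>simon_instances n d. \<Sum>p\<in>simon_pairs n. F (I[t := p])) = (\<Sum>(I, p)\<in>?X. F (I[t := p]))"
    by (simp add: sum.cartesian_product)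
  also have "\<dots> = (\<Sum>(I, p)\<in>?X. F I)"
    by (rule sum.reindex_bij_witness[where i = "\<lambda>(I, p). (I[t := p], I ! t)" and j = "\<lambda>(I, p). (I[t := p], I ! t)"])
      (use mem assms in \<open>auto simp: simon_instances_def\<close>)
  also have "\<dots> = real (card (simon_pairs n)) * (\<Sum>I\<in>simon_instances n d. F I)"
    by (simp add: sum.cartesian_product[symmetric] sum_distrib_left)
  finally show ?thesis .
qed

subsection \<open>Classical circuits\<close>

fun gate_queries :: "(bits \<Rightarrow> bits) \<Rightarrow> cgate list \<Rightarrow> bits \<Rightarrow> bits list" where
  "gate_queries Orc [] ws = []"
| "gate_queries Orc (g # gs) ws =
     (case g of CQuery qs \<Rightarrow> [map (get ws) qs] | _ \<Rightarrow> []) @ gate_queries Orc gs (cg_step Orc ws g)"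

text \<open>While the answers agree, so do the wires and hence the next query. Agreement on the
  transcript of one run thus suffices; this is the locality that \<open>simon_period_hidden\<close>
  asks of a payoff.\<close>

lemma gate_queries_cong:
  assumes "\<forall>u\<in>set (gate_queries Orc gs ws). Orc' u = Orc u"
  shows "gate_queries Orc' gs ws = gate_queries Orc gs ws"
    and "foldl (cg_step Orc') ws gs = foldl (cg_step Orc) ws gs"
proof -
  have "gate_queries Orc' gs ws = gate_queries Orc gs ws \<and> foldl (cg_step Orc') ws gs = foldl (cg_step Orc) ws gs"
    using assms
  proof (induction gs arbitrary: ws)
    case (Cons g gs)
    have "cg_step Orc' ws g = cg_step Orc ws g"
      using Cons.prems by (cases g) auto
    with Cons show ?case by simp
  qed simp
  then show "gate_queries Orc' gs ws = gate_queries Orc gs ws"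
    and "foldl (cg_step Orc') ws gs = foldl (cg_step Orc) ws gs" by auto
qed

lemma ceval_cong:
  assumes "\<forall>u\<in>set (gate_queries Orc (fst C) ws). Orc' u = Orc u"
  shows "ceval Orc' C ws = ceval Orc C ws"
  unfolding ceval_def gate_queries_cong(2)[OF assms] ..

lemma length_gate_queries: "length (gate_queries Orc gs ws) \<le> length gs"
proof (induction gs arbitrary: ws)
  case (Cons g gs)
  show ?case using Cons[of "cg_step Orc ws g"] by (cases g) auto
qed simp

lemma length_gates_le_csize: "length (fst C) \<le> csize C"
proof -
  have "length gs \<le> sum_list (map cg_size gs)" for gs
  proof (induction gs)
    case (Cons g gs)
    then show ?case by (cases g) auto
  qed simp
  then show ?thesis by (simp add: csize_def trans_le_add1)
qed

subsection \<open>Quantum states\<close>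

definition weight :: "nat \<Rightarrow> (bits \<Rightarrow> bool) \<Rightarrow> qstate \<Rightarrow> real" where
  "weight m B \<psi> = (\<Sum>w | length w = m. if B w then (cmod (\<psi> w))\<^sup>2 else 0)"

lemma sqnorm_nonneg: "0 \<le> sqnorm m \<psi>"
  by (simp add: sqnorm_def sum_nonneg)

lemma weight_nonneg: "0 \<le> weight m B \<psi>"
  by (simp add: weight_def sum_nonneg)

lemma weight_le_sqnorm: "weight m B \<psi> \<le> sqnorm m \<psi>"
  unfolding weight_def sqnorm_def by (intro sum_mono) auto

lemma sqnorm_eq_weight: "sqnorm m \<psi> = weight m (\<lambda>_. True) \<psi>"
  by (simp add: weight_def sqnorm_def)

lemma sqnorm_zero_state: "sqnorm m (zero_state m) = 1"
proof -
  have "sqnorm m (zero_state m) = (\<Sum>w | length w = m. if replicate m False = w then 1 else 0)"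
    unfolding sqnorm_def zero_state_def by (intro sum.cong) auto
  then show ?thesis by (simp add: sum.delta')
qed

text \<open>Follows from \<open>(cmod a - cmod b)\<^sup>2 \<ge> 0\<close>. It stands in for the
  triangle inequality on squared norms and is the source of the factor 2 per hybrid step.\<close>

lemma cmod_add_sq_le: "(cmod (a + b))\<^sup>2 \<le> 2 * (cmod a)\<^sup>2 + 2 * (cmod b)\<^sup>2"
proof -
  have "(cmod (a + b))\<^sup>2 \<le> (cmod a + cmod b)\<^sup>2"
    by (intro power_mono norm_triangle_ineq) auto
  also have "\<dots> \<le> 2 * (cmod a)\<^sup>2 + 2 * (cmod b)\<^sup>2"
    using zero_le_power2[of "cmod a - cmod b"] by (simp add: power2_sum power2_diff)
  finally show ?thesis .
qed

lemma weight_add: "weight m B (\<lambda>w. a w + b w) \<le> 2 * weight m B a + 2 * weight m B b"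
proof -
  have "weight m B (\<lambda>w. a w + b w)
      \<le> (\<Sum>w | length w = m. 2 * (if B w then (cmod (a w))\<^sup>2 else 0) + 2 * (if B w then (cmod (b w))\<^sup>2 else 0))"
    unfolding weight_def by (intro sum_mono) (auto simp: cmod_add_sq_le)
  then show ?thesis
    by (simp add: weight_def sum.distrib sum_distrib_left)
qed

lemma sqnorm_add: "sqnorm m (\<lambda>w. a w + b w) \<le> 2 * sqnorm m a + 2 * sqnorm m b"
  unfolding sqnorm_eq_weight by (rule weight_add)

lemma apply_gate_add:
  "apply_gate cm g (\<lambda>w. a w + b w) = (\<lambda>w. apply_gate cm g a w + apply_gate cm g b w)"
  by (cases g) (auto simp: apply1_def apply2_def fun_eq_iff sum.distrib distrib_left)

lemma apply_layer_add:
  "apply_layer cm gs (\<lambda>w. a w + b w) = (\<lambda>w. apply_layer cm gs a w + apply_layer cm gs b w)"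
  unfolding apply_layer_def by (induction gs) (simp_all add: apply_gate_add)

lemma apply_queries_add:
  "apply_queries F Ss (\<lambda>w. a w + b w) = (\<lambda>w. apply_queries F Ss a w + apply_queries F Ss b w)"
  unfolding apply_queries_def by (induction Ss) (simp_all add: apply_query_def)

lemma project_add: "project M ob (\<lambda>w. a w + b w) = (\<lambda>w. project M ob a w + project M ob b w)"
  by (simp add: project_def fun_eq_iff)

text \<open>Each basis string is compatible with exactly one outcome, namely
  \<open>sel w M\<close>.\<close>

lemma sum_sqnorm_project: "(\<Sum>ob | length ob = length M. sqnorm m (project M ob \<psi>)) = sqnorm m \<psi>"
proof -
  have "(\<Sum>ob | length ob = length M. sqnorm m (project M ob \<psi>))
      = (\<Sum>w | length w = m. \<Sum>ob | length ob = length M. if sel w M = ob then (cmod (\<psi> w))\<^sup>2 else 0)"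
    unfolding sqnorm_def project_def by (subst sum.swap) (intro sum.cong, auto)
  also have "\<dots> = sqnorm m \<psi>"
    unfolding sqnorm_def by (intro sum.cong refl) (simp add: sum.delta' sel_def)
  finally show ?thesis .
qed

section \<open>Gates and layers preserve the norm\<close>

text \<open>Expanding the square leaves the inner products of the columns of \<open>U\<close>. The
  index type is general to serve both one-qubit (\<open>bool\<close>) and two-qubit
  (\<open>bool \<times> bool\<close>) gates.\<close>

lemma isometry_sum:
  fixes U :: "'i::finite \<Rightarrow> 'i \<Rightarrow> complex"
  assumes "\<forall>i j. (\<Sum>k\<in>UNIV. cnj (U k i) * U k j) = (if i = j then 1 else 0)"
  shows "(\<Sum>a\<in>UNIV. (cmod (\<Sum>b\<in>UNIV. U a b * v b))\<^sup>2) = (\<Sum>b\<in>UNIV. (cmod (v b))\<^sup>2)"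
proof -
  have sq: "complex_of_real ((cmod z)\<^sup>2) = cnj z * z" for z
    by (simp only: complex_norm_square mult.commute)
  have "complex_of_real (\<Sum>a\<in>UNIV. (cmod (\<Sum>b\<in>UNIV. U a b * v b))\<^sup>2)
      = (\<Sum>a\<in>UNIV. cnj (\<Sum>b\<in>UNIV. U a b * v b) * (\<Sum>c\<in>UNIV. U a c * v c))"
    by (simp only: of_real_sum sq)
  also have "\<dots> = (\<Sum>a\<in>UNIV. \<Sum>b\<in>UNIV. \<Sum>c\<in>UNIV. cnj (v b) * v c * (cnj (U a b) * U a c))"
    unfolding cnj_sum sum_product by (simp add: mult_ac)
  also have "\<dots> = (\<Sum>b\<in>UNIV. \<Sum>a\<in>UNIV. \<Sum>c\<in>UNIV. cnj (v b) * v c * (cnj (U a b) * U a c))"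
    by (rule sum.swap)
  also have "\<dots> = (\<Sum>b\<in>UNIV. \<Sum>c\<in>UNIV. \<Sum>a\<in>UNIV. cnj (v b) * v c * (cnj (U a b) * U a c))"
    by (intro sum.cong refl sum.swap)
  also have "\<dots> = (\<Sum>b\<in>UNIV. \<Sum>c\<in>UNIV. cnj (v b) * v c * (if b = c then 1 else 0))"
    using assms by (simp add: sum_distrib_left[symmetric])
  also have "\<dots> = (\<Sum>b\<in>UNIV. cnj (v b) * v b)"
    by (simp add: sum.delta if_distrib cong: if_cong)
  also have "\<dots> = complex_of_real (\<Sum>b\<in>UNIV. (cmod (v b))\<^sup>2)"
    by (simp only: of_real_sum sq)
  finally show ?thesis by (simp only: of_real_eq_iff)
qed

text \<open>Overwriting bit \<open>q\<close> in all ways reaches every string twice. A sum over all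
  strings is thereby grouped into pairs on which a gate acts as a small matrix.\<close>

lemma sum_over_bit:
  fixes h :: "bits \<Rightarrow> real"
  assumes "q < m"
  shows "(\<Sum>w | length w = m. \<Sum>a\<in>UNIV. h (w[q := a])) = 2 * (\<Sum>w | length w = m. h w)"
proof -
  have "(\<Sum>a\<in>UNIV. h (w[q := a])) = h w + h (w[q := \<not> w ! q])" if "length w = m" for w
    using list_update_id[of w q] by (cases "w ! q") (simp_all add: UNIV_bool)
  then have "(\<Sum>w | length w = m. \<Sum>a\<in>UNIV. h (w[q := a])) = (\<Sum>w | length w = m. h w + h (w[q := \<not> w ! q]))"
    by (intro sum.cong) auto
  moreover have "(\<Sum>w | length w = m. h (w[q := \<not> w ! q])) = (\<Sum>w | length w = m. h w)"
    by (rule sum.reindex_bij_witness[of _ "\<lambda>w. w[q := \<not> w ! q]" "\<lambda>w. w[q := \<not> w ! q]"])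
      (use assms in auto)
  ultimately show ?thesis by (simp add: sum.distrib)
qed

lemma sqnorm_apply1:
  assumes "unitary1 U" "q < m"
  shows "sqnorm m (apply1 q U \<psi>) = sqnorm m \<psi>"
proof -
  have "2 * sqnorm m (apply1 q U \<psi>) = (\<Sum>w | length w = m. \<Sum>a\<in>UNIV. (cmod (apply1 q U \<psi> (w[q := a])))\<^sup>2)"
    unfolding sqnorm_def by (rule sum_over_bit[OF assms(2), symmetric])
  also have "\<dots> = (\<Sum>w | length w = m. \<Sum>a\<in>UNIV. (cmod (\<Sum>b\<in>UNIV. U a b * \<psi> (w[q := b])))\<^sup>2)"
    using assms(2) by (intro sum.cong) (auto simp: apply1_def get_def)
  also have "\<dots> = (\<Sum>w | length w = m. \<Sum>b\<in>UNIV. (cmod (\<psi> (w[q := b])))\<^sup>2)"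
    by (simp only: isometry_sum[OF assms(1)[unfolded unitary1_def]])
  also have "\<dots> = 2 * sqnorm m \<psi>"
    unfolding sqnorm_def by (rule sum_over_bit[OF assms(2)])
  finally show ?thesis by simp
qed

lemma sqnorm_apply2:
  assumes "unitary2 U" "q1 < m" "q2 < m" "q1 \<noteq> q2"
  shows "sqnorm m (apply2 q1 q2 U \<psi>) = sqnorm m \<psi>"
proof -
  have two: "(\<Sum>w | length w = m. \<Sum>p\<in>UNIV. h (w[q1 := fst p, q2 := snd p])) = 4 * (\<Sum>w | length w = m. h w)"
    for h :: "bits \<Rightarrow> real"
  proof -
    have "(\<Sum>w | length w = m. \<Sum>p\<in>UNIV. h (w[q1 := fst p, q2 := snd p]))
        = (\<Sum>w | length w = m. \<Sum>a\<in>UNIV. \<Sum>b\<in>UNIV. h (w[q1 := a, q2 := b]))"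
      by (simp add: sum.cartesian_product case_prod_beta)
    also have "\<dots> = 2 * (\<Sum>w | length w = m. \<Sum>b\<in>UNIV. h (w[q2 := b]))"
      by (rule sum_over_bit[OF assms(2)])
    also have "\<dots> = 4 * (\<Sum>w | length w = m. h w)"
      by (simp add: sum_over_bit[OF assms(3)])
    finally show ?thesis .
  qed
  have "4 * sqnorm m (apply2 q1 q2 U \<psi>)
      = (\<Sum>w | length w = m. \<Sum>p\<in>UNIV. (cmod (apply2 q1 q2 U \<psi> (w[q1 := fst p, q2 := snd p])))\<^sup>2)"
    unfolding sqnorm_def by (rule two[symmetric])
  also have "\<dots> = (\<Sum>w | length w = m. \<Sum>p\<in>UNIV. (cmod (\<Sum>r\<in>UNIV. U p r * \<psi> (w[q1 := fst r, q2 := snd r])))\<^sup>2)"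
  proof (intro sum.cong refl)
    fix w :: bits and p :: "bool \<times> bool" assume "w \<in> {w. length w = m}"
    then have "apply2 q1 q2 U \<psi> (w[q1 := fst p, q2 := snd p])
        = (\<Sum>r\<in>UNIV. U p r * \<psi> (w[q1 := fst r, q2 := snd r]))"
      using assms(2-4) by (auto simp: apply2_def get_def list_update_swap[of q1 q2])
    then show "(cmod (apply2 q1 q2 U \<psi> (w[q1 := fst p, q2 := snd p])))\<^sup>2
        = (cmod (\<Sum>r\<in>UNIV. U p r * \<psi> (w[q1 := fst r, q2 := snd r])))\<^sup>2" by simp
  qed
  also have "\<dots> = (\<Sum>w | length w = m. \<Sum>p\<in>UNIV. (cmod (\<psi> (w[q1 := fst p, q2 := snd p])))\<^sup>2)"
    by (simp only: isometry_sum[OF assms(1)[unfolded unitary2_def]])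
  also have "\<dots> = 4 * sqnorm m \<psi>"
    unfolding sqnorm_def by (rule two)
  finally show ?thesis by simp
qed

lemma sqnorm_apply_layer:
  assumes "layer_ok m gs"
  shows "sqnorm m (apply_layer cm gs \<psi>) = sqnorm m \<psi>"
  using assms
proof (induction gs)
  case (Cons g gs)
  have "layer_ok m gs"
    using Cons.prems by (auto simp: layer_ok_def)
  then have "sqnorm m (apply_layer cm gs \<psi>) = sqnorm m \<psi>" by (rule Cons.IH)
  moreover have "sqnorm m (apply_gate cm g \<phi>) = sqnorm m \<phi>" for \<phi>
    using Cons.prems by (cases g) (auto simp: layer_ok_def sqnorm_apply1 sqnorm_apply2)
  ultimately show ?case by (simp add: apply_layer_def)
qed (simp add: apply_layer_def)

section \<open>Parallel queries as permutations of basis strings\<close>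

lemma length_upd_bits [simp]: "length (upd_bits w qs v) = length w"
  by (induction w qs v rule: upd_bits.induct) (auto split: list.split)

lemma get_upd_bits_other: "i \<notin> set qs \<Longrightarrow> get (upd_bits w qs v) i = get w i"
  by (induction w qs v rule: upd_bits.induct) (auto split: list.split simp: get_def)

lemma sel_upd_bits_other: "set xs \<inter> set qs = {} \<Longrightarrow> sel (upd_bits w qs v) xs = sel w xs"
  using get_upd_bits_other by (fastforce simp: sel_def)

lemma sel_upd_bits_same:
  "distinct qs \<Longrightarrow> \<forall>q\<in>set qs. q < length w \<Longrightarrow> length v = length qs \<Longrightarrow> sel (upd_bits w qs v) qs = v"
proof (induction w qs v rule: upd_bits.induct)
  case (2 w i qs v)
  then show ?case
    by (cases v) (auto simp: sel_def get_upd_bits_other, auto simp: get_def)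
qed (simp add: sel_def)

lemma upd_bits_update: "i \<notin> set qs \<Longrightarrow> upd_bits (w[i := b]) qs v = (upd_bits w qs v)[i := b]"
proof (induction w qs v rule: upd_bits.induct)
  case (2 w j qs v)
  then show ?case
    by (cases v) (auto simp: list_update_swap)
qed simp

lemma upd_bits_upd_bits:
  "distinct qs \<Longrightarrow> length v = length v' \<Longrightarrow> upd_bits (upd_bits w qs v) qs v' = upd_bits w qs v'"
proof (induction qs arbitrary: w v v')
  case (Cons i qs)
  then show ?case
    by (cases v; cases v') (auto simp: upd_bits_update[symmetric])
qed simp

lemma upd_bits_sel: "\<forall>q\<in>set qs. q < length w \<Longrightarrow> upd_bits w qs (sel w qs) = w"
  by (induction qs arbitrary: w) (auto simp: sel_def get_def)

text \<open>The action of a query on basis strings. It is an involution on well-formed slots, so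
  composing the amplitude with it is the usual query unitary.\<close>

definition query_slot :: "(bits \<Rightarrow> bits) \<Rightarrow> nat list \<times> nat list \<Rightarrow> bits \<Rightarrow> bits" where
  "query_slot F S w = upd_bits w (snd S) (bxor (sel w (snd S)) (F (sel w (fst S))))"

lemma apply_query_eq: "apply_query F S \<psi> = (\<lambda>w. \<psi> (query_slot F S w))"
  by (simp add: apply_query_def query_slot_def)

text \<open>Keeps from \<open>slots_ok\<close> the facts behind the estimates below: above all, no
  query writes to an input register, its own or that of another slot.\<close>

definition slots_disjoint :: "nat \<Rightarrow> nat \<Rightarrow> (nat list \<times> nat list) list \<Rightarrow> bool" where
  "slots_disjoint m l Ss \<longleftrightarrow> (\<forall>S\<in>set Ss. distinct (snd S) \<and> length (snd S) = l \<and> (\<forall>q\<in>set (snd S). q < m)) \<and>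
     (\<forall>S\<in>set Ss. \<forall>S'\<in>set Ss. set (fst S) \<inter> set (snd S') = {})"

lemma slots_ok_disjoint:
  assumes "slots_ok n d m Ss"
  shows "slots_disjoint m (oracle_out_len n) Ss"
proof -
  have "distinct (concat (map (\<lambda>S. fst S @ snd S) Ss)) \<Longrightarrow>
      \<forall>S\<in>set Ss. distinct (snd S) \<and> (\<forall>S'\<in>set Ss. set (fst S) \<inter> set (snd S') = {})"
  proof (induction Ss)
    case (Cons T Ss)
    let ?R = "\<Union>S\<in>set Ss. set (fst S) \<union> set (snd S)"
    have "distinct (snd T)" "set (fst T) \<inter> set (snd T) = {}"
      "set (fst T) \<inter> ?R = {}" "set (snd T) \<inter> ?R = {}"
      using Cons.prems by auto
    moreover have "\<forall>S\<in>set Ss. distinct (snd S) \<and> (\<forall>S'\<in>set Ss. set (fst S) \<inter> set (snd S') = {})"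
      using Cons by simp
    ultimately show ?case by simp blast
  qed simp
  moreover have "\<forall>S\<in>set Ss. length (snd S) = oracle_out_len n \<and> (\<forall>q\<in>set (snd S). q < m)"
    using assms by (auto simp: slots_ok_def)
  ultimately show ?thesis
    using assms unfolding slots_disjoint_def slots_ok_def by blast
qed

text \<open>Every slot owns at least one qubit of its own, since the answer register has
  \<open>Suc n\<close> of them. Hence the number of qubits bounds the parallel queries.\<close>

lemma length_slots_le:
  assumes "slots_ok n d m Ss"
  shows "length Ss \<le> m"
proof -
  let ?c = "concat (map (\<lambda>S. fst S @ snd S) Ss)"
  have "\<forall>S\<in>set Ss. snd S \<noteq> []"
    using assms by (auto simp: slots_ok_def oracle_out_len_def)
  then have "length Ss \<le> length ?c"
    by (induction Ss) (auto simp: neq_Nil_conv)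
  also have "length ?c = card (set ?c)"
  proof (rule distinct_card[symmetric])
    show "distinct ?c" using assms unfolding slots_ok_def by blast
  qed
  also have "\<dots> \<le> card {..<m}"
    using assms by (intro card_mono) (auto simp: slots_ok_def)
  finally show ?thesis by simp
qed

text \<open>The input register is untouched, so the same answer is xored in twice.\<close>

lemma query_slot_involution:
  assumes "slots_disjoint m l Ss" "S \<in> set Ss" "length w = m" "\<And>u. length (F u) = l"
  shows "query_slot F S (query_slot F S w) = w"
proof -
  have S: "distinct (snd S)" "length (snd S) = l" "\<forall>q\<in>set (snd S). q < length w" "set (fst S) \<inter> set (snd S) = {}"
    using assms by (auto simp: slots_disjoint_def)
  let ?v = "bxor (sel w (snd S)) (F (sel w (fst S)))"
  have l: "length (sel w (snd S)) = l" by (simp add: sel_def S)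
  have "query_slot F S (query_slot F S w) = upd_bits (upd_bits w (snd S) ?v) (snd S) (bxor ?v (F (sel w (fst S))))"
    using S l by (simp add: query_slot_def sel_upd_bits_other sel_upd_bits_same assms(4))
  also have "\<dots> = w"
    using S l assms(4) by (simp add: bxor_bxor_cancel upd_bits_upd_bits upd_bits_sel)
  finally show ?thesis .
qed

definition slot_hits :: "(bits \<Rightarrow> bool) \<Rightarrow> (nat list \<times> nat list) list \<Rightarrow> bits \<Rightarrow> bool" where
  "slot_hits Z Ss w \<longleftrightarrow> (\<exists>S\<in>set Ss. Z (sel w (fst S)))"

lemma slot_hits_query_slot:
  assumes "slots_disjoint m l Ss" "S \<in> set Ss" "set Ts \<subseteq> set Ss"
  shows "slot_hits Z Ts (query_slot F S w) \<longleftrightarrow> slot_hits Z Ts w"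
proof -
  have "sel (query_slot F S w) (fst T) = sel w (fst T)" if "T \<in> set Ts" for T
  proof -
    have "T \<in> set Ss" using that assms(3) by blast
    then show ?thesis
      using assms(1,2) unfolding query_slot_def by (intro sel_upd_bits_other) (simp add: slots_disjoint_def)
  qed
  then show ?thesis by (simp add: slot_hits_def)
qed

text \<open>A query permutes basis strings and leaves all input registers alone, so it never moves
  amplitude into or out of the hitting set. The induction runs over \<open>Ts\<close> while that set
  stays the one for all slots \<open>Ss\<close>.\<close>

lemma weight_apply_queries:
  assumes "slots_disjoint m l Ss" "set Ts \<subseteq> set Ss" "\<And>u. length (F u) = l"
  shows "weight m (slot_hits Z Ss) (apply_queries F Ts \<psi>) = weight m (slot_hits Z Ss) \<psi>"
  using assms(2)
proof (induction Ts)
  case (Cons S Ts)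
  let ?\<phi> = "apply_queries F Ts \<psi>"
  have "weight m (slot_hits Z Ss) (apply_query F S ?\<phi>) = weight m (slot_hits Z Ss) ?\<phi>"
    unfolding weight_def apply_query_eq
    by (rule sum.reindex_bij_witness[of _ "query_slot F S" "query_slot F S"])
      (use Cons.prems assms query_slot_involution[OF assms(1), where F = F] slot_hits_query_slot[OF assms(1), where F = F]
        in \<open>auto simp: query_slot_def\<close>)
  with Cons show ?case by (simp add: apply_queries_def)
qed (simp add: apply_queries_def)

lemma sqnorm_apply_queries:
  assumes "slots_disjoint m l Ss" "\<And>u. length (F u) = l"
  shows "sqnorm m (apply_queries F Ss \<psi>) = sqnorm m \<psi>"
proof (cases "Ss = []")
  case False
  \<comment> \<open>With at least one slot every string hits the trivial condition, so the weight is
    the whole squared norm; without slots nothing happens.\<close>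
  then have "slot_hits (\<lambda>_. True) Ss = (\<lambda>_. True)"
    by (cases Ss) (auto simp: slot_hits_def fun_eq_iff)
  then show ?thesis
    using weight_apply_queries[OF assms(1) subset_refl assms(2), where Z = "\<lambda>_. True"]
    by (simp add: sqnorm_eq_weight)
qed (simp add: apply_queries_def)

lemma apply_queries_agree:
  assumes "slots_disjoint m l Ss" "set Ts \<subseteq> set Ss" "\<And>u. \<not> Z u \<Longrightarrow> F u = F' u" "\<not> slot_hits Z Ss w"
  shows "apply_queries F Ts \<psi> w = apply_queries F' Ts \<psi> w"
  using assms(2,4)
proof (induction Ts arbitrary: w)
  case (Cons S Ts)
  have "F (sel w (fst S)) = F' (sel w (fst S))"
    using Cons.prems assms(3) by (auto simp: slot_hits_def)
  then have "query_slot F S w = query_slot F' S w" by (simp add: query_slot_def)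
  moreover have "\<not> slot_hits Z Ss (query_slot F' S w)"
    using Cons.prems slot_hits_query_slot[OF assms(1) _ subset_refl] by auto
  ultimately show ?case
    using Cons by (simp add: apply_queries_def apply_query_eq)
qed (simp add: apply_queries_def)

text \<open>The two results differ only on hitting strings, and there each still carries the weight
  that \<open>\<psi>\<close> had. The constant is \<open>2 + 2\<close> from
  \<open>weight_add\<close>.\<close>

lemma sqnorm_apply_queries_diff:
  assumes "slots_disjoint m l Ss" "\<And>u. length (F u) = l" "\<And>u. length (F' u) = l"
    and "\<And>u. \<not> Z u \<Longrightarrow> F u = F' u"
  shows "sqnorm m (\<lambda>w. apply_queries F Ss \<psi> w - apply_queries F' Ss \<psi> w) \<le> 4 * weight m (slot_hits Z Ss) \<psi>"
proof -
  let ?a = "apply_queries F Ss \<psi>" and ?b = "\<lambda>w. - apply_queries F' Ss \<psi> w"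
  have "sqnorm m (\<lambda>w. apply_queries F Ss \<psi> w - apply_queries F' Ss \<psi> w)
      = weight m (slot_hits Z Ss) (\<lambda>w. ?a w + ?b w)"
    unfolding sqnorm_def weight_def
    using apply_queries_agree[where Z = Z and F = F and F' = F', OF assms(1) subset_refl assms(4)] by (intro sum.cong) auto
  also have "\<dots> \<le> 2 * weight m (slot_hits Z Ss) ?a + 2 * weight m (slot_hits Z Ss) ?b"
    by (rule weight_add)
  also have "weight m (slot_hits Z Ss) ?b = weight m (slot_hits Z Ss) (apply_queries F' Ss \<psi>)"
    by (simp add: weight_def cong: if_cong)
  finally show ?thesis
    using weight_apply_queries[OF assms(1) subset_refl, where Z = Z and \<psi> = \<psi>] assms(2,3) by simp
qed

lemma sqnorm_step:
  assumes "step_ok n d m st" "\<And>u. length (Orc u) = oracle_out_len n"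
  shows "sqnorm m (apply_queries Orc (qslots st) (apply_layer cm (layer st) \<psi>)) = sqnorm m \<psi>"
proof -
  have "slots_disjoint m (oracle_out_len n) (qslots st)" "layer_ok m (layer st)"
    using assms(1) slots_ok_disjoint by (auto simp: step_ok_def)
  then show ?thesis
    using assms(2) by (simp add: sqnorm_apply_queries sqnorm_apply_layer)
qed

section \<open>The success weight as a function of the state\<close>

lemma exec_nonneg: "0 \<le> exec Orc m tgt sts Af cm \<psi>"
  by (induction sts arbitrary: cm \<psi>) (simp_all add: Let_def sum_nonneg sqnorm_nonneg)

lemma exec_le_sqnorm:
  assumes "\<forall>st\<in>set sts. step_ok n d m st" "\<And>u. length (Orc u) = oracle_out_len n"
  shows "exec Orc m tgt sts Af cm \<psi> \<le> sqnorm m \<psi>"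
  using assms(1)
proof (induction sts arbitrary: cm \<psi>)
  case (Cons st sts)
  define cm1 where "cm1 = ceval Orc (cc st) cm"
  define \<psi>1 where "\<psi>1 = apply_queries Orc (qslots st) (apply_layer cm1 (layer st) \<psi>)"
  have "exec Orc m tgt (st # sts) Af cm \<psi>
      \<le> (\<Sum>ob | length ob = length (meas st). sqnorm m (project (meas st) ob \<psi>1))"
    using Cons by (simp add: Let_def cm1_def \<psi>1_def sum_mono)
  also have "\<dots> = sqnorm m \<psi>1" by (rule sum_sqnorm_project)
  also have "\<dots> = sqnorm m \<psi>"
    unfolding \<psi>1_def using Cons.prems assms(2) by (intro sqnorm_step) auto
  finally show ?case .
qed (simp add: sqnorm_nonneg)

text \<open>This replaces the trace-distance estimates of the usual hybrid argument.\<close>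
lemma exec_add:
  "exec Orc m tgt sts Af cm (\<lambda>w. a w + b w) \<le> 2 * exec Orc m tgt sts Af cm a + 2 * exec Orc m tgt sts Af cm b"
proof (induction sts arbitrary: cm a b)
  case (Cons st sts)
  show ?case
    by (simp add: Let_def apply_layer_add apply_queries_add project_add sum_distrib_left
        sum.distrib[symmetric] sum_mono Cons)
qed (simp add: sqnorm_add)

subsection \<open>Hybrid runs\<close>

text \<open>One step of \<open>exec\<close> with the rest of the run abstracted to a payoff
  \<open>G\<close>, so that the rest may use another oracle.\<close>

definition branch_sum :: "(bits \<Rightarrow> bits) \<Rightarrow> qcstep \<Rightarrow> (bits \<Rightarrow> qstate \<Rightarrow> real) \<Rightarrow> bits \<Rightarrow> qstate \<Rightarrow> real" where
  "branch_sum Orc st G cm \<psi> =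
     (let cm1 = ceval Orc (cc st) cm;
          \<psi>1 = apply_queries Orc (qslots st) (apply_layer cm1 (layer st) \<psi>)
      in \<Sum>ob | length ob = length (meas st). G (cm1 @ ob) (project (meas st) ob \<psi>1))"

lemma branch_sum_mono:
  "(\<And>cm \<psi>. G cm \<psi> \<le> G' cm \<psi>) \<Longrightarrow> branch_sum Orc st G cm \<psi> \<le> branch_sum Orc st G' cm \<psi>"
  by (simp add: branch_sum_def Let_def sum_mono)

lemma branch_sum_sum:
  "branch_sum Orc st (\<lambda>cm \<psi>. \<Sum>p\<in>A. G p cm \<psi>) cm \<psi> = (\<Sum>p\<in>A. branch_sum Orc st (G p) cm \<psi>)"
  unfolding branch_sum_def Let_def by (rule sum.swap)

lemma branch_sum_linear:
  "branch_sum Orc st (\<lambda>cm \<psi>. a * G cm \<psi> + H cm \<psi>) cm \<psi> = a * branch_sum Orc st G cm \<psi> + branch_sum Orc st H cm \<psi>"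
  by (simp add: branch_sum_def Let_def sum.distrib sum_distrib_left)

lemma branch_sum_sqnorm:
  assumes "step_ok n d m st" "\<And>u. length (Orc u) = oracle_out_len n"
  shows "branch_sum Orc st (\<lambda>_ \<psi>. c * sqnorm m \<psi>) cm \<psi> = c * sqnorm m \<psi>"
proof -
  have "branch_sum Orc st (\<lambda>_ \<psi>. c * sqnorm m \<psi>) cm \<psi>
      = c * sqnorm m (apply_queries Orc (qslots st) (apply_layer (ceval Orc (cc st) cm) (layer st) \<psi>))"
    by (simp add: branch_sum_def Let_def sum_distrib_left[symmetric] sum_sqnorm_project)
  also have "sqnorm m (apply_queries Orc (qslots st) (apply_layer (ceval Orc (cc st) cm) (layer st) \<psi>)) = sqnorm m \<psi>"
    using assms by (rule sqnorm_step)
  finally show ?thesis .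
qed

text \<open>Step \<open>k\<close> runs with its own oracle \<open>Orcs k\<close>, and
  \<open>G\<close> is the payoff at the end. The hybrid argument appends steps at the end of this
  prefix, hence the form of \<open>hybrid_snoc\<close>.\<close>

definition hybrid :: "(nat \<Rightarrow> bits \<Rightarrow> bits) \<Rightarrow> qcstep list \<Rightarrow> (bits \<Rightarrow> qstate \<Rightarrow> real) \<Rightarrow> bits \<Rightarrow> qstate \<Rightarrow> real" where
  "hybrid Orcs sts G = foldr (\<lambda>(k, st). branch_sum (Orcs k) st) (enumerate 0 sts) G"

lemma hybrid_Nil [simp]: "hybrid Orcs [] G = G"
  by (simp add: hybrid_def)

lemma hybrid_snoc: "hybrid Orcs (sts @ [st]) G = hybrid Orcs sts (branch_sum (Orcs (length sts)) st G)"
  by (simp add: hybrid_def enumerate_append_eq)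

lemma hybrid_mono:
  "(\<And>cm \<psi>. G cm \<psi> \<le> G' cm \<psi>) \<Longrightarrow> hybrid Orcs sts G cm \<psi> \<le> hybrid Orcs sts G' cm \<psi>"
proof (induction sts arbitrary: G G' rule: rev_induct)
  case (snoc st sts)
  show ?case
    unfolding hybrid_snoc by (intro snoc.IH branch_sum_mono snoc.prems)
qed simp

lemma hybrid_sum:
  "hybrid Orcs sts (\<lambda>cm \<psi>. \<Sum>p\<in>A. G p cm \<psi>) cm \<psi> = (\<Sum>p\<in>A. hybrid Orcs sts (G p) cm \<psi>)"
  by (induction sts arbitrary: G rule: rev_induct) (simp_all add: hybrid_snoc branch_sum_sum[abs_def])

lemma hybrid_linear:
  "hybrid Orcs sts (\<lambda>cm \<psi>. a * G cm \<psi> + H cm \<psi>) cm \<psi> = a * hybrid Orcs sts G cm \<psi> + hybrid Orcs sts H cm \<psi>"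
  by (induction sts arbitrary: G H rule: rev_induct) (simp_all add: hybrid_snoc branch_sum_linear[abs_def])

lemma hybrid_sqnorm:
  assumes "\<forall>st\<in>set sts. step_ok n d m st" "\<And>k u. length (Orcs k u) = oracle_out_len n"
  shows "hybrid Orcs sts (\<lambda>_ \<psi>. c * sqnorm m \<psi>) cm \<psi> = c * sqnorm m \<psi>"
  using assms(1)
proof (induction sts rule: rev_induct)
  case (snoc st sts)
  then have "branch_sum (Orcs (length sts)) st (\<lambda>_ \<psi>. c * sqnorm m \<psi>) = (\<lambda>_ \<psi>. c * sqnorm m \<psi>)"
    using branch_sum_sqnorm[of n d m st "Orcs (length sts)"] assms(2) by (simp add: fun_eq_iff)
  with snoc show ?case by (simp add: hybrid_snoc)
qed simp

lemma hybrid_cong: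
  "(\<And>k. k < length sts \<Longrightarrow> Orcs k = Orcs' k) \<Longrightarrow> hybrid Orcs sts G = hybrid Orcs' sts G"
  by (induction sts arbitrary: G rule: rev_induct) (simp_all add: hybrid_snoc)

text \<open>Either some classical query already hits \<open>Z\<close>, or the
  step states of the two runs differ only on basis states whose quantum queries hit \<open>Z\<close>.\<close>
lemma exec_step_replace:
  assumes ok: "step_ok n d m st" "\<forall>st\<in>set sts. step_ok n d m st"
    and len: "\<And>u. length (F u) = oracle_out_len n" "\<And>u. length (F' u) = oracle_out_len n"
    and Z: "\<And>u. \<not> Z u \<Longrightarrow> F u = F' u"
  shows "exec F m tgt (st # sts) Af cm \<psi> \<le> 2 * branch_sum F' st (exec F m tgt sts Af) cm \<psi>
     + ((if \<exists>u\<in>set (gate_queries F' (fst (cc st)) cm). Z u then sqnorm m \<psi> else 0)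
        + 8 * weight m (slot_hits Z (qslots st)) (apply_layer (ceval F' (cc st) cm) (layer st) \<psi>))"
proof (cases "\<exists>u\<in>set (gate_queries F' (fst (cc st)) cm). Z u")
  case True
  have "exec F m tgt (st # sts) Af cm \<psi> \<le> sqnorm m \<psi>"
    using exec_le_sqnorm[of "st # sts" n d m F] ok len by simp
  moreover have "0 \<le> branch_sum F' st (exec F m tgt sts Af) cm \<psi>"
    by (simp add: branch_sum_def Let_def sum_nonneg exec_nonneg)
  ultimately show ?thesis using True weight_nonneg[of m "slot_hits Z (qslots st)"] by (simp add: add_increasing add_increasing2)
next
  case False
  define cm1 where "cm1 = ceval F' (cc st) cm"
  have cm1: "ceval F (cc st) cm = cm1"
    unfolding cm1_def using False Z by (intro ceval_cong) auto
  define \<psi>0 where "\<psi>0 = apply_layer cm1 (layer st) \<psi>"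
  define \<phi> where "\<phi> = apply_queries F' (qslots st) \<psi>0"
  define \<delta> where "\<delta> = (\<lambda>w. apply_queries F (qslots st) \<psi>0 w - \<phi> w)"
  define E where "E \<chi> = (\<Sum>ob | length ob = length (meas st). exec F m tgt sts Af (cm1 @ ob) (project (meas st) ob \<chi>))" for \<chi>
  have "exec F m tgt (st # sts) Af cm \<psi> = E (\<lambda>w. \<phi> w + \<delta> w)"
    by (simp add: Let_def cm1 E_def \<delta>_def \<psi>0_def)
  also have "\<dots> \<le> 2 * E \<phi> + 2 * E \<delta>"
    unfolding E_def project_add sum_distrib_left sum.distrib[symmetric]
    by (intro sum_mono exec_add)
  also have "E \<phi> = branch_sum F' st (exec F m tgt sts Af) cm \<psi>"
    by (simp add: branch_sum_def Let_def E_def \<phi>_def \<psi>0_def cm1_def)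
  also have "E \<delta> \<le> (\<Sum>ob | length ob = length (meas st). sqnorm m (project (meas st) ob \<delta>))"
    unfolding E_def using exec_le_sqnorm[of sts n d m F] ok len by (intro sum_mono) auto
  also have "\<dots> = sqnorm m \<delta>" by (rule sum_sqnorm_project)
  \<comment> \<open>Together with the factor 2 in front of \<open>E \<delta>\<close> this gives the
    constant 8.\<close>
  also have "\<dots> \<le> 4 * weight m (slot_hits Z (qslots st)) \<psi>0"
    unfolding \<delta>_def \<phi>_def
    using ok len Z by (intro sqnorm_apply_queries_diff[OF slots_ok_disjoint]) (auto simp: step_ok_def)
  finally show ?thesis using False by (simp add: \<psi>0_def cm1_def)
qed

subsection \<open>Truncated oracles\<close>

definition z_part :: "nat \<Rightarrow> nat \<Rightarrow> bits \<Rightarrow> bits" where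
  "z_part n d u = drop (Suc d + n) u"

text \<open>Level \<open>i\<close> is unlocked by the period of component \<open>i - 1\<close>, so
  this oracle depends only on the functions of components \<open>0..k\<close> and the periods of
  components below \<open>k\<close>.\<close>

definition shadow :: "nat \<Rightarrow> nat \<Rightarrow> nat \<Rightarrow> ((bits \<Rightarrow> bits) \<times> bits) list \<Rightarrow> bits \<Rightarrow> bits" where
  "shadow n d k I u = (if bin_nat (take (Suc d) u) \<le> k then serial_oracle n d I u else bot_str n)"

lemma length_serial_oracle:
  assumes "I \<in> simon_instances n d"
  shows "length (serial_oracle n d I u) = oracle_out_len n"
proof -
  have "length (fst (I ! i) x) = n" if "i \<le> d" "length x = n" for i x
  proof -
    have "I ! i \<in> set I" using assms that by (simp add: simon_instances_def)
    then show ?thesis using assms that by (simp add: simon_instances_def is_simon_def)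
  qed
  then show ?thesis
    by (simp add: serial_oracle_def Let_def bot_str_def val_str_def oracle_out_len_def oracle_in_len_def)
qed

lemma length_shadow:
  "I \<in> simon_instances n d \<Longrightarrow> length (shadow n d k I u) = oracle_out_len n"
  by (simp add: shadow_def length_serial_oracle) (simp add: bot_str_def oracle_out_len_def)

text \<open>A truncated level \<open>i\<close> with \<open>k < i \<le> d\<close> answers other than
  bottom only when the \<open>z\<close> part is the period of component \<open>i - 1\<close>; these
  indices form \<open>{k..<d}\<close>.\<close>

lemma serial_oracle_eq_shadow:
  assumes "\<not> (\<exists>t\<in>{k..<d}. z_part n d u = snd (I ! t))"
  shows "serial_oracle n d I u = shadow n d k I u"
proof (cases "bin_nat (take (Suc d) u) \<le> k")
  case False
  let ?i = "bin_nat (take (Suc d) u)"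
  have "z_part n d u \<noteq> snd (I ! (?i - 1))" if "?i \<le> d"
    using that False assms by (metis Suc_diff_1 Suc_leI atLeastLessThan_iff less_imp_le_nat less_Suc_eq_le not_le not_less0 gr0I)
  with False show ?thesis
    by (auto simp: shadow_def serial_oracle_def Let_def z_part_def)
qed (simp add: shadow_def)

lemma shadow_update_later:
  "k < t \<Longrightarrow> shadow n d k (I[t := p]) = shadow n d k I"
  by (simp add: fun_eq_iff shadow_def serial_oracle_def Let_def)

text \<open>Levels up to \<open>k\<close> look at periods of index below \<open>k \<le> t\<close>
  only, so the period at \<open>t\<close> may be arbitrary; the function at \<open>t\<close> enters
  through its value at the queried point.\<close>

lemma shadow_update_cong:
  assumes "k \<le> t" "t < length I"
    and "length u = oracle_in_len n d \<Longrightarrow> f' (take n (drop (Suc d) u)) = f (take n (drop (Suc d) u))"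
  shows "shadow n d k (I[t := (f', s')]) u = shadow n d k (I[t := (f, s)]) u"
proof -
  let ?i = "bin_nat (take (Suc d) u)"
  have "snd (I[t := (f', s')] ! (?i - 1)) = snd (I[t := (f, s)] ! (?i - 1))" if "?i \<noteq> 0" "?i \<le> k"
  proof -
    have "t \<noteq> ?i - 1" using that assms(1) by linarith
    then show ?thesis by simp
  qed
  moreover have "fst (I[t := (f', s')] ! i) (take n (drop (Suc d) u)) = fst (I[t := (f, s)] ! i) (take n (drop (Suc d) u))"
    if "length u = oracle_in_len n d" for i
    using assms(2,3) that by (cases "i = t") auto
  ultimately show ?thesis
    by (simp add: shadow_def serial_oracle_def Let_def)
qed

text \<open>Stage \<open>k\<close> sees component \<open>t \<ge> k\<close> of the instance through classical queries only, and never its period.\<close>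
lemma sum_payoff_resampled_le:
  fixes V :: "(bits \<Rightarrow> bits) \<Rightarrow> bits \<Rightarrow> real"
  assumes I: "k \<le> t" "t < length I"
    and loc: "\<And>Orc Orc'. (\<forall>u\<in>set (gate_queries Orc gs cm). Orc' u = Orc u) \<Longrightarrow> V Orc' = V Orc"
    and V: "\<And>Orc s. 0 \<le> V Orc s" "\<And>Orc s. V Orc s \<le> W" "\<And>Orc. (\<Sum>s | length s = n. V Orc s) \<le> K"
  shows "(2 ^ n - 1) * (\<Sum>p\<in>simon_pairs n. V (shadow n d k (I[t := p])) (snd p))
       \<le> real (card (simon_pairs n)) * (K + real (length gs) ^ 2 * W)"
    and "finite (simon_pairs n)"
proof -
  let ?x = "\<lambda>u. take n (drop (Suc d) u)"
  \<comment> \<open>The empty list is a placeholder period; \<open>shadow_update_cong\<close> shows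
    that it does not affect the answers.\<close>
  define Of where "Of f = shadow n d k (I[t := (f, [])])" for f
  \<comment> \<open>Queries of the wrong length or on truncated levels get bottom whatever
    \<open>f\<close> is. The length filter also ensures that the points in \<open>Q f\<close> have
    \<open>n\<close> bits.\<close>
  define Q where "Q f = ?x ` {u \<in> set (gate_queries (Of f) gs cm). length u = oracle_in_len n d}" for f
  have Of: "shadow n d k (I[t := p]) = Of (fst p)" for p
    using shadow_update_cong[OF I, of _ n d "fst p" "fst p" "snd p" "[]"] by (simp add: Of_def fun_eq_iff)
  have loc': "Q f' = Q f \<and> V (Of f') = V (Of f)" if "\<And>x. x \<in> Q f \<Longrightarrow> f' x = f x" for f f'
  proof -
    have "\<forall>u\<in>set (gate_queries (Of f) gs cm). Of f' u = Of f u"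
      using that unfolding Of_def by (intro ballI shadow_update_cong[OF I]) (simp add: Q_def Of_def)
    then show ?thesis
      using loc[of "Of f" "Of f'"] gate_queries_cong(1)[of "Of f" gs cm "Of f'"] by (simp add: Q_def)
  qed
  have "card (Q f) \<le> length gs" for f
  proof -
    have "card (Q f) \<le> card (set (gate_queries (Of f) gs cm))"
      unfolding Q_def by (intro order.trans[OF card_image_le] card_mono) auto
    then show ?thesis
      using card_length length_gate_queries order.trans by metis
  qed
  moreover have "Q f \<subseteq> {x. length x = n}" for f
    by (auto simp: Q_def oracle_in_len_def)
  ultimately show "(2 ^ n - 1) * (\<Sum>p\<in>simon_pairs n. V (shadow n d k (I[t := p])) (snd p))
       \<le> real (card (simon_pairs n)) * (K + real (length gs) ^ 2 * W)" and "finite (simon_pairs n)"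
    using simon_period_hidden[of Q "\<lambda>f. V (Of f)" n "length gs" W K, OF loc'] V by (simp_all add: Of)
qed

section \<open>Average error of one truncation\<close>

text \<open>The error term of \<open>exec_step_replace\<close>.\<close>

definition step_error :: "nat \<Rightarrow> (bits \<Rightarrow> bool) \<Rightarrow> (bits \<Rightarrow> bits) \<Rightarrow> qcstep \<Rightarrow> bits \<Rightarrow> qstate \<Rightarrow> real" where
  "step_error m Z Orc st cm \<psi> =
     (if \<exists>u\<in>set (gate_queries Orc (fst (cc st)) cm). Z u then sqnorm m \<psi> else 0)
       + 8 * weight m (slot_hits Z (qslots st)) (apply_layer (ceval Orc (cc st) cm) (layer st) \<psi>)"

lemma weight_slot_hits_UN:
  assumes "finite T"
  shows "weight m (slot_hits (\<lambda>u. \<exists>t\<in>T. Z t u) Ss) \<psi> \<le> (\<Sum>t\<in>T. weight m (slot_hits (Z t) Ss) \<psi>)"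
proof -
  have "(if slot_hits (\<lambda>u. \<exists>t\<in>T. Z t u) Ss w then (cmod (\<psi> w))\<^sup>2 else 0)
      \<le> (\<Sum>t\<in>T. if slot_hits (Z t) Ss w then (cmod (\<psi> w))\<^sup>2 else 0)" for w
  proof (cases "slot_hits (\<lambda>u. \<exists>t\<in>T. Z t u) Ss w")
    case True
    then obtain t where t: "t \<in> T" "slot_hits (Z t) Ss w" by (auto simp: slot_hits_def)
    show ?thesis
      using member_le_sum[OF t(1), of "\<lambda>t. if slot_hits (Z t) Ss w then (cmod (\<psi> w))\<^sup>2 else 0"] t True assms by simp
  qed (simp add: sum_nonneg)
  then show ?thesis
    unfolding weight_def by (subst sum.swap) (intro sum_mono)
qed

lemma step_error_UN:
  assumes "finite T"
  shows "step_error m (\<lambda>u. \<exists>t\<in>T. Z t u) Orc st cm \<psi> \<le> (\<Sum>t\<in>T. step_error m (Z t) Orc st cm \<psi>)"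
proof -
  let ?q = "set (gate_queries Orc (fst (cc st)) cm)"
  have "(if \<exists>u\<in>?q. \<exists>t\<in>T. Z t u then sqnorm m \<psi> else 0) \<le> (\<Sum>t\<in>T. if \<exists>u\<in>?q. Z t u then sqnorm m \<psi> else 0)"
  proof (cases "\<exists>u\<in>?q. \<exists>t\<in>T. Z t u")
    case True
    then obtain t where t: "t \<in> T" "\<exists>u\<in>?q. Z t u" by auto
    show ?thesis
      using member_le_sum[OF t(1), of "\<lambda>t. if \<exists>u\<in>?q. Z t u then sqnorm m \<psi> else 0"] t True assms
      by (simp add: sqnorm_nonneg)
  qed (simp add: sum_nonneg sqnorm_nonneg)
  then show ?thesis
    unfolding step_error_def sum.distrib sum_distrib_left[symmetric]
    by (intro add_mono mult_left_mono weight_slot_hits_UN assms) auto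
qed

text \<open>The slots of a basis string show at most \<open>length Ss\<close> different
  \<open>z\<close> values, so its amplitude is counted for at most that many periods.\<close>

lemma sum_weight_slot_hits_le:
  fixes z :: "bits \<Rightarrow> bits"
  shows "(\<Sum>s | length s = n. weight m (slot_hits (\<lambda>u. z u = s) Ss) \<psi>) \<le> real (length Ss) * sqnorm m \<psi>"
proof -
  have "(\<Sum>s | length s = n. if slot_hits (\<lambda>u. z u = s) Ss w then (cmod (\<psi> w))\<^sup>2 else 0)
      \<le> real (length Ss) * (cmod (\<psi> w))\<^sup>2" for w
  proof -
    have "{s \<in> {s. length s = n}. slot_hits (\<lambda>u. z u = s) Ss w} \<subseteq> set (map (\<lambda>S. z (sel w (fst S))) Ss)"
      by (auto simp: slot_hits_def)
    then have "card {s \<in> {s. length s = n}. slot_hits (\<lambda>u. z u = s) Ss w} \<le> length Ss"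
      by (metis (no_types, lifting) List.finite_set card_length card_mono length_map order.trans)
    then show ?thesis
      by (simp only: sum_bool_indicator[OF finite_bits]) (simp add: mult_right_mono)
  qed
  then show ?thesis
    unfolding weight_def sqnorm_def sum_distrib_left by (subst sum.swap) (intro sum_mono)
qed

lemma sum_query_hits_le:
  fixes z :: "bits \<Rightarrow> bits"
  assumes "0 \<le> c"
  shows "(\<Sum>s | length s = n. if \<exists>u\<in>set us. z u = s then c else 0) \<le> real (length us) * c"
proof -
  have "{s \<in> {s. length s = n}. \<exists>u\<in>set us. z u = s} \<subseteq> set (map z us)" by auto
  then have "card {s \<in> {s. length s = n}. \<exists>u\<in>set us. z u = s} \<le> length us"
    by (metis (no_types, lifting) List.finite_set card_length card_mono length_map order.trans)
  then show ?thesis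
    using assms by (simp only: sum_bool_indicator[OF finite_bits]) (simp add: mult_right_mono)
qed

text \<open>Here \<open>b\<close> bounds circuit sizes and the number of qubits. A step error is at
  most \<open>1 + 8 = 9\<close> squared norms, and its sum over all periods at most
  \<open>9 * b\<close>; with at most \<open>b\<close> classical queries,
  \<open>9 * b + 9 * b ^ 2\<close> is below \<open>9 * (b + 1) ^ 2\<close>.\<close>

definition hiding_error :: "nat \<Rightarrow> nat \<Rightarrow> real" where
  "hiding_error n b = 9 * (real b + 1) ^ 2 / (2 ^ n - 1)"

lemma le_hiding_error:
  assumes "n \<ge> 1" "(2 ^ n - 1) * x \<le> real c * (9 * (real b + 1) ^ 2 * y)"
  shows "x \<le> hiding_error n b * real c * y"
proof -
  have "(2::real) ^ n > 1" using assms(1) by (simp add: one_less_power)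
  then show ?thesis
    using assms(2) by (simp add: hiding_error_def field_simps)
qed

text \<open>The hitting weight is taken before the quantum query, so the error depends on the oracle
  only through the classical subroutine. Hence \<open>sum_payoff_resampled_le\<close> applies even
  though the step queries in superposition.\<close>

lemma sum_step_error_le:
  assumes n: "n \<ge> 1" and I: "k \<le> t" "t < length I"
    and ok: "step_ok n d m st" "csize (cc st) \<le> b" "m \<le> b"
  shows "(\<Sum>p\<in>simon_pairs n. step_error m (\<lambda>u. z_part n d u = snd p) (shadow n d k (I[t := p])) st cm \<psi>)
       \<le> hiding_error n b * real (card (simon_pairs n)) * sqnorm m \<psi>"
proof -
  define V where "V Orc s = step_error m (\<lambda>u. z_part n d u = s) Orc st cm \<psi>" for Orc s
  let ?gs = "fst (cc st)"
  note nn = sqnorm_nonneg[of m \<psi>]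
  have lay: "sqnorm m (apply_layer c (layer st) \<psi>) = sqnorm m \<psi>" for c
    using ok by (simp add: step_ok_def sqnorm_apply_layer)
  have L: "length ?gs \<le> b" and S: "length (qslots st) \<le> b"
    using ok length_gates_le_csize[of "cc st"] length_slots_le[of n d m "qslots st"] by (auto simp: step_ok_def)
  have wl: "weight m B (apply_layer c (layer st) \<psi>) \<le> sqnorm m \<psi>" for B c
    using weight_le_sqnorm lay by metis
  have "V Orc' = V Orc" if "\<forall>u\<in>set (gate_queries Orc ?gs cm). Orc' u = Orc u" for Orc Orc'
    using gate_queries_cong(1)[OF that] ceval_cong[OF that] by (simp add: V_def step_error_def fun_eq_iff)
  moreover have "0 \<le> V Orc s" for Orc s
    by (simp add: V_def step_error_def nn weight_nonneg)
  moreover have "V Orc s \<le> 9 * sqnorm m \<psi>" for Orc s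
    using wl[of "slot_hits (\<lambda>u. z_part n d u = s) (qslots st)" "ceval Orc (cc st) cm"] nn by (simp add: V_def step_error_def)
  moreover have "(\<Sum>s | length s = n. V Orc s) \<le> 9 * real b * sqnorm m \<psi>" for Orc
  proof -
    have "(\<Sum>s | length s = n. V Orc s)
        \<le> real (length (gate_queries Orc ?gs cm)) * sqnorm m \<psi> + 8 * (real (length (qslots st)) * sqnorm m \<psi>)"
      unfolding V_def step_error_def sum.distrib sum_distrib_left[symmetric]
      using sum_weight_slot_hits_le[where n = n and m = m and z = "z_part n d" and Ss = "qslots st"
          and \<psi> = "apply_layer (ceval Orc (cc st) cm) (layer st) \<psi>"]
      by (intro add_mono mult_left_mono sum_query_hits_le nn) (auto simp: lay)
    also have "\<dots> \<le> real b * sqnorm m \<psi> + 8 * (real b * sqnorm m \<psi>)"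
      using L S length_gate_queries[of Orc ?gs cm] by (intro add_mono mult_left_mono mult_right_mono nn) auto
    finally show ?thesis by (simp add: algebra_simps)
  qed
  ultimately have "(2 ^ n - 1) * (\<Sum>p\<in>simon_pairs n. V (shadow n d k (I[t := p])) (snd p))
      \<le> real (card (simon_pairs n)) * (9 * real b * sqnorm m \<psi> + real (length ?gs) ^ 2 * (9 * sqnorm m \<psi>))"
    by (intro sum_payoff_resampled_le(1)[OF I])
  also have "\<dots> \<le> real (card (simon_pairs n)) * (9 * (real b + 1) ^ 2 * sqnorm m \<psi>)"
  proof (intro mult_left_mono)
    have "real (length ?gs) ^ 2 \<le> real b ^ 2" using L by (intro power_mono) auto
    moreover have "(real b + 1) ^ 2 = real b ^ 2 + 2 * real b + 1" by (simp add: power2_sum)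
    ultimately have "9 * real b + real (length ?gs) ^ 2 * 9 \<le> 9 * (real b + 1) ^ 2"
      using zero_le_power2[of "real b"] by linarith
    then show "9 * real b * sqnorm m \<psi> + real (length ?gs) ^ 2 * (9 * sqnorm m \<psi>) \<le> 9 * (real b + 1) ^ 2 * sqnorm m \<psi>"
      using mult_right_mono[OF _ nn] by (fastforce simp: algebra_simps)
  qed auto
  finally show ?thesis
    unfolding V_def by (rule le_hiding_error[OF n])
qed

text \<open>The final circuit is classical and its output equals at most one candidate period, so
  its payoffs sum to at most one squared norm.\<close>

lemma sum_final_guess_le:
  assumes n: "n \<ge> 1" and I: "d < length I" and C: "csize C \<le> b"
  shows "(\<Sum>p\<in>simon_pairs n. if ceval (serial_oracle n d (I[d := p])) C cm = snd p then sqnorm m \<psi> else 0)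
       \<le> hiding_error n b * real (card (simon_pairs n)) * sqnorm m \<psi>"
proof -
  define V where "V Orc s = (if ceval Orc C cm = s then sqnorm m \<psi> else 0)" for Orc s
  note nn = sqnorm_nonneg[of m \<psi>]
  have L: "length (fst C) \<le> b" using C length_gates_le_csize[of C] by simp
  have "V Orc' = V Orc" if "\<forall>u\<in>set (gate_queries Orc (fst C) cm). Orc' u = Orc u" for Orc Orc'
    using ceval_cong[OF that] by (simp add: V_def fun_eq_iff)
  moreover have "0 \<le> V Orc s" "V Orc s \<le> sqnorm m \<psi>" for Orc s
    by (simp_all add: V_def nn)
  moreover have "(\<Sum>s | length s = n. V Orc s) \<le> sqnorm m \<psi>" for Orc
    using nn by (simp add: V_def sum.delta')
  ultimately have "(2 ^ n - 1) * (\<Sum>p\<in>simon_pairs n. V (shadow n d d (I[d := p])) (snd p))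
      \<le> real (card (simon_pairs n)) * (sqnorm m \<psi> + real (length (fst C)) ^ 2 * sqnorm m \<psi>)"
    by (intro sum_payoff_resampled_le(1)[OF order.refl I])
  also have "\<dots> \<le> real (card (simon_pairs n)) * (9 * (real b + 1) ^ 2 * sqnorm m \<psi>)"
  proof (intro mult_left_mono)
    have "real (length (fst C)) ^ 2 \<le> real b ^ 2" using L by (intro power_mono) auto
    moreover have "(real b + 1) ^ 2 = real b ^ 2 + 2 * real b + 1" by (simp add: power2_sum)
    ultimately have "1 + real (length (fst C)) ^ 2 \<le> 9 * (real b + 1) ^ 2"
      using zero_le_power2[of "real b"] by linarith
    then show "sqnorm m \<psi> + real (length (fst C)) ^ 2 * sqnorm m \<psi> \<le> 9 * (real b + 1) ^ 2 * sqnorm m \<psi>"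
      using mult_right_mono[OF _ nn] by (fastforce simp: algebra_simps)
  qed auto
  finally have "(\<Sum>p\<in>simon_pairs n. V (shadow n d d (I[d := p])) (snd p))
      \<le> hiding_error n b * real (card (simon_pairs n)) * sqnorm m \<psi>"
    by (rule le_hiding_error[OF n])
  \<comment> \<open>The range \<open>{d..<d}\<close> is empty: truncation above the top level
    changes nothing.\<close>
  moreover have "shadow n d d J = serial_oracle n d J" for J
    using serial_oracle_eq_shadow[of d d] by (simp add: fun_eq_iff)
  ultimately show ?thesis by (simp add: V_def)
qed

section \<open>Averaging over instances and the hybrid induction\<close>

text \<open>Step \<open>k\<close> of the prefix has \<open>k < length pre \<le> t\<close>, so its
  truncated oracle is blind to component \<open>t\<close>. That component can be resampled and the
  average moved to the end of the prefix, where \<open>G\<close> is bounded by a multiple of the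
  norm, which the prefix preserves.\<close>

lemma sum_hybrid_le:
  assumes t: "length pre \<le> t" "t \<le> d"
    and ok: "\<forall>st\<in>set pre. step_ok n d m st"
    and G: "\<And>I cm \<psi>. length I = Suc d \<Longrightarrow> (\<Sum>p\<in>simon_pairs n. G (I[t := p]) cm \<psi>) \<le> \<epsilon> * real (card (simon_pairs n)) * sqnorm m \<psi>"
    and fin: "finite (simon_pairs n)"
  shows "(\<Sum>I\<in>simon_instances n d. hybrid (\<lambda>k. shadow n d k I) pre (G I) cm \<psi>)
       \<le> \<epsilon> * real (card (simon_instances n d)) * sqnorm m \<psi>"
proof (cases "simon_pairs n = {}")
  case True
  \<comment> \<open>The main case divides by the number of pairs; with no pairs there are no
    instances.\<close>
  have "I ! 0 \<in> simon_pairs n" if "I \<in> simon_instances n d" for I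
  proof -
    have "I ! 0 \<in> set I" using that by (simp add: simon_instances_def)
    then show ?thesis using that by (simp add: simon_instances_def simon_pairs_def)
  qed
  with True have "simon_instances n d = {}" by auto
  then show ?thesis by simp
next
  case False
  define c where "c = real (card (simon_pairs n))"
  have c: "c > 0" using False fin by (simp add: c_def card_gt_0_iff)
  have "c * (\<Sum>I\<in>simon_instances n d. hybrid (\<lambda>k. shadow n d k I) pre (G I) cm \<psi>)
      = (\<Sum>I\<in>simon_instances n d. \<Sum>p\<in>simon_pairs n. hybrid (\<lambda>k. shadow n d k (I[t := p])) pre (G (I[t := p])) cm \<psi>)"
    unfolding c_def
    by (rule sum_simon_instances_resample[OF t(2), of "\<lambda>I. hybrid (\<lambda>k. shadow n d k I) pre (G I) cm \<psi>", symmetric])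
  also have "\<dots> \<le> (\<Sum>I\<in>simon_instances n d. \<epsilon> * c * sqnorm m \<psi>)"
  proof (rule sum_mono)
    fix I assume I: "I \<in> simon_instances n d"
    have "hybrid (\<lambda>k. shadow n d k (I[t := p])) pre = hybrid (\<lambda>k. shadow n d k I) pre" for p
      by (rule ext, rule hybrid_cong) (use t in \<open>simp add: shadow_update_later\<close>)
    then have "(\<Sum>p\<in>simon_pairs n. hybrid (\<lambda>k. shadow n d k (I[t := p])) pre (G (I[t := p])) cm \<psi>)
        = (\<Sum>p\<in>simon_pairs n. hybrid (\<lambda>k. shadow n d k I) pre (G (I[t := p])) cm \<psi>)"
      by simp
    also have "\<dots> = hybrid (\<lambda>k. shadow n d k I) pre (\<lambda>cm \<psi>. \<Sum>p\<in>simon_pairs n. G (I[t := p]) cm \<psi>) cm \<psi>"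
      by (rule hybrid_sum[symmetric])
    also have "\<dots> \<le> hybrid (\<lambda>k. shadow n d k I) pre (\<lambda>_ \<psi>. (\<epsilon> * c) * sqnorm m \<psi>) cm \<psi>"
      using I G unfolding c_def by (intro hybrid_mono) (simp add: simon_instances_def)
    also have "\<dots> = \<epsilon> * c * sqnorm m \<psi>"
      by (rule hybrid_sqnorm[OF ok]) (rule length_shadow[OF I])
    finally show "(\<Sum>p\<in>simon_pairs n. hybrid (\<lambda>k. shadow n d k (I[t := p])) pre (G (I[t := p])) cm \<psi>) \<le> \<epsilon> * c * sqnorm m \<psi>" .
  qed
  also have "\<dots> = c * (\<epsilon> * real (card (simon_instances n d)) * sqnorm m \<psi>)" by simp
  finally show ?thesis using c by simp
qed

lemma finite_simon_pairs: "finite (simon_pairs n)"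
  by (rule simon_period_hidden(2)[of "\<lambda>_. {}" "\<lambda>_ _. 0" n 0 0 0]) auto

text \<open>Induction on the steps still using the true oracle, truncating the first of them each
  time. In units of \<open>Suc d\<close> hiding errors the bound obeys \<open>a' = 2 * a + 1\<close>
  from \<open>a = 1\<close>, solved by \<open>2 ^ Suc (length sts) - 1\<close>; the unit covers the
  at most \<open>d\<close> hidden periods of a step as well as the final guess.\<close>

lemma sum_hybrid_exec_le:
  assumes n: "n \<ge> 1" and b: "m \<le> b" "csize Af \<le> b"
    and ok: "\<forall>st\<in>set (pre @ sts). step_ok n d m st \<and> csize (cc st) \<le> b"
    and len: "length pre + length sts = d"
  shows "(\<Sum>I\<in>simon_instances n d.
            hybrid (\<lambda>k. shadow n d k I) pre (exec (serial_oracle n d I) m (snd (I ! d)) sts Af) cm \<psi>)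
       \<le> (2 ^ Suc (length sts) - 1) * (real (Suc d) * hiding_error n b * real (card (simon_instances n d)) * sqnorm m \<psi>)"
  using ok len
proof (induction sts arbitrary: pre)
  case Nil
  define B where "B = hiding_error n b * real (card (simon_instances n d)) * sqnorm m \<psi>"
  have "hiding_error n b \<ge> 0" by (simp add: hiding_error_def)
  then have "0 \<le> B" by (simp add: B_def sqnorm_nonneg)
  have "(\<Sum>I\<in>simon_instances n d.
            hybrid (\<lambda>k. shadow n d k I) pre (exec (serial_oracle n d I) m (snd (I ! d)) [] Af) cm \<psi>) \<le> B"
    unfolding B_def
    using Nil sum_final_guess_le[OF n _ b(2)] finite_simon_pairs
    by (intro sum_hybrid_le[where t = d]) auto
  also have "\<dots> \<le> real (Suc d) * B"
    using \<open>0 \<le> B\<close> by (simp add: algebra_simps)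
  finally show ?case by (simp add: B_def mult.assoc del: exec.simps)
next
  case (Cons st sts)
  let ?k = "length pre"
  let ?O = "\<lambda>I. serial_oracle n d I" and ?sh = "\<lambda>I k. shadow n d k I"
  let ?E = "\<lambda>I. exec (?O I) m (snd (I ! d)) sts Af"
  let ?err = "\<lambda>t I. step_error m (\<lambda>u. z_part n d u = snd (I ! t)) (shadow n d ?k I) st"
  define B where "B = hiding_error n b * real (card (simon_instances n d)) * sqnorm m \<psi>"
  have "hiding_error n b \<ge> 0" by (simp add: hiding_error_def)
  then have B: "0 \<le> B" by (simp add: B_def sqnorm_nonneg)
  have "hybrid (?sh I) pre (exec (?O I) m (snd (I ! d)) (st # sts) Af) cm \<psi>
      \<le> 2 * hybrid (?sh I) (pre @ [st]) (?E I) cm \<psi> + (\<Sum>t\<in>{?k..<d}. hybrid (?sh I) pre (?err t I) cm \<psi>)"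
    if I: "I \<in> simon_instances n d" for I
  proof -
    have "exec (?O I) m (snd (I ! d)) (st # sts) Af cm \<psi>
        \<le> 2 * branch_sum (shadow n d ?k I) st (?E I) cm \<psi> + (\<Sum>t\<in>{?k..<d}. ?err t I cm \<psi>)" for cm \<psi>
    proof -
      have "exec (?O I) m (snd (I ! d)) (st # sts) Af cm \<psi>
        \<le> 2 * branch_sum (shadow n d ?k I) st (?E I) cm \<psi>
          + step_error m (\<lambda>u. \<exists>t\<in>{?k..<d}. z_part n d u = snd (I ! t)) (shadow n d ?k I) st cm \<psi>"
        unfolding step_error_def
        using Cons.prems
        by (intro exec_step_replace[where n = n and d = d] serial_oracle_eq_shadow length_shadow[OF I] length_serial_oracle[OF I]) auto
      then show ?thesis
        using step_error_UN[of "{?k..<d}" m "\<lambda>t u. z_part n d u = snd (I ! t)" "shadow n d ?k I" st cm \<psi>] by simp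
    qed
    then have "hybrid (?sh I) pre (exec (?O I) m (snd (I ! d)) (st # sts) Af) cm \<psi>
      \<le> hybrid (?sh I) pre (\<lambda>cm \<psi>. 2 * branch_sum (shadow n d ?k I) st (?E I) cm \<psi> + (\<Sum>t\<in>{?k..<d}. ?err t I cm \<psi>)) cm \<psi>"
      by (rule hybrid_mono)
    then show ?thesis
      by (simp only: hybrid_linear hybrid_sum hybrid_snoc)
  qed
  then have "(\<Sum>I\<in>simon_instances n d. hybrid (?sh I) pre (exec (?O I) m (snd (I ! d)) (st # sts) Af) cm \<psi>)
      \<le> (\<Sum>I\<in>simon_instances n d. 2 * hybrid (?sh I) (pre @ [st]) (?E I) cm \<psi> + (\<Sum>t\<in>{?k..<d}. hybrid (?sh I) pre (?err t I) cm \<psi>))"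
    by (rule sum_mono)
  also have "\<dots> = 2 * (\<Sum>I\<in>simon_instances n d. hybrid (?sh I) (pre @ [st]) (?E I) cm \<psi>)
      + (\<Sum>t\<in>{?k..<d}. \<Sum>I\<in>simon_instances n d. hybrid (?sh I) pre (?err t I) cm \<psi>)"
    by (simp only: sum.distrib sum_distrib_left sum.swap[of _ "{?k..<d}"])
  also have "\<dots> \<le> 2 * ((2 ^ Suc (length sts) - 1) * (real (Suc d) * B)) + (\<Sum>t\<in>{?k..<d}. B)"
  proof (intro add_mono mult_left_mono sum_mono)
    show "(\<Sum>I\<in>simon_instances n d. hybrid (?sh I) (pre @ [st]) (?E I) cm \<psi>)
        \<le> (2 ^ Suc (length sts) - 1) * (real (Suc d) * B)"
      using Cons.IH[of "pre @ [st]"] Cons.prems by (simp add: B_def mult.assoc)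
  next
    fix t assume t: "t \<in> {?k..<d}"
    show "(\<Sum>I\<in>simon_instances n d. hybrid (?sh I) pre (?err t I) cm \<psi>) \<le> B"
      unfolding B_def
    proof (rule sum_hybrid_le[where t = t])
      fix I :: "((bits \<Rightarrow> bits) \<times> bits) list" and cm \<psi> assume I: "length I = Suc d"
      have "(\<Sum>p\<in>simon_pairs n. ?err t (I[t := p]) cm \<psi>)
          = (\<Sum>p\<in>simon_pairs n. step_error m (\<lambda>u. z_part n d u = snd p) (shadow n d ?k (I[t := p])) st cm \<psi>)"
        using I t by (intro sum.cong) auto
      also have "\<dots> \<le> hiding_error n b * real (card (simon_pairs n)) * sqnorm m \<psi>"
        using I t Cons.prems b by (intro sum_step_error_le[OF n]) auto
      finally show "(\<Sum>p\<in>simon_pairs n. ?err t (I[t := p]) cm \<psi>) \<le> hiding_error n b * real (card (simon_pairs n)) * sqnorm m \<psi>" .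
    qed (use t Cons.prems finite_simon_pairs in auto)
  qed auto
  also have "\<dots> \<le> 2 * ((2 ^ Suc (length sts) - 1) * (real (Suc d) * B)) + real (Suc d) * B"
    using B by (simp add: mult_right_mono)
  also have "\<dots> = (2 ^ Suc (length (st # sts)) - 1) * (real (Suc d) * B)"
    by (simp add: algebra_simps)
  finally show ?case by (simp add: B_def mult.assoc del: exec.simps)
qed

lemma success_prob_le:
  assumes n: "n \<ge> 1" and b: "nq C \<le> b" "csize (final C) \<le> b"
    and ok: "\<forall>st\<in>set (steps C). step_ok n d (nq C) st \<and> csize (cc st) \<le> b"
    and len: "length (steps C) = d"
  shows "success_prob n d C \<le> 2 ^ Suc d * real (Suc d) * hiding_error n b"
proof -
  define N where "N = real (card (simon_instances n d))"
  define B where "B = 2 ^ Suc d * real (Suc d) * hiding_error n b"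
  have h: "hiding_error n b \<ge> 0" by (simp add: hiding_error_def)
  then have B: "B \<ge> 0" by (simp add: B_def)
  have r: "(\<Sum>I\<in>simon_instances n d. exec (serial_oracle n d I) (nq C) (snd (I ! d)) (steps C) (final C) r (zero_state (nq C)))
      \<le> B * N" for r
  proof -
    have "(\<Sum>I\<in>simon_instances n d. exec (serial_oracle n d I) (nq C) (snd (I ! d)) (steps C) (final C) r (zero_state (nq C)))
      \<le> (2 ^ Suc d - 1) * (real (Suc d) * hiding_error n b * N)"
      using sum_hybrid_exec_le[OF n b, of "[]" "steps C" d r "zero_state (nq C)"] ok len by (simp add: sqnorm_zero_state N_def)
    also have "\<dots> \<le> 2 ^ Suc d * (real (Suc d) * hiding_error n b * N)"
      using h by (intro mult_right_mono) (auto simp: N_def)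
    finally show ?thesis by (simp add: B_def mult_ac)
  qed
  have "(\<Sum>I\<in>simon_instances n d. \<Sum>r | length r = nrand C.
      exec (serial_oracle n d I) (nq C) (snd (I ! d)) (steps C) (final C) r (zero_state (nq C)))
     \<le> real (card {r :: bits. length r = nrand C}) * (B * N)"
    by (subst sum.swap) (rule sum_bounded_above[OF r])
  then have "(\<Sum>I\<in>simon_instances n d. \<Sum>r | length r = nrand C.
      exec (serial_oracle n d I) (nq C) (snd (I ! d)) (steps C) (final C) r (zero_state (nq C)))
     \<le> B * (N * 2 ^ nrand C)"
    by (simp add: card_bits mult_ac)
  \<comment> \<open>For \<open>N = 0\<close> the quotient is 0 by convention, and \<open>B\<close>
    is nonnegative.\<close>
  then have "success_prob n d C \<le> B"
    using B unfolding success_prob_def N_def[symmetric]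
    by (cases "N = 0") (simp_all add: divide_le_eq N_def)
  then show ?thesis by (simp add: B_def)
qed

section \<open>Asymptotics and conclusion\<close>

lemma power_over_two_power_tendsto_0: "(\<lambda>n. (real n + 1) ^ j / 2 ^ n) \<longlonglongrightarrow> 0"
proof -
  have x: "filterlim (\<lambda>n. real n * ln 2) at_top sequentially"
    by (intro filterlim_at_top_mult_tendsto_pos[OF tendsto_const] filterlim_real_sequentially) simp
  \<comment> \<open>For \<open>n > 0\<close>,
    \<open>n + 1 \<le> 2 * n = (2 / ln 2) * (n * ln 2)\<close>, and \<open>2 ^ n\<close> is the
    exponential of \<open>n * ln 2\<close>.\<close>
  have lim: "(\<lambda>n. (2 / ln 2) ^ j * ((real n * ln 2) ^ j / exp (real n * ln 2))) \<longlonglongrightarrow> (2 / ln 2) ^ j * 0"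
    by (intro tendsto_mult tendsto_const filterlim_compose[OF tendsto_power_div_exp_0 x])
  show ?thesis
  proof (rule tendsto_sandwich[OF _ _ tendsto_const])
    show "(\<lambda>n. (2 / ln 2) ^ j * ((real n * ln 2) ^ j / exp (real n * ln 2))) \<longlonglongrightarrow> 0"
      using lim by simp
    show "\<forall>\<^sub>F n in sequentially. (real n + 1) ^ j / 2 ^ n \<le> (2 / ln 2) ^ j * ((real n * ln 2) ^ j / exp (real n * ln 2))"
      using eventually_gt_at_top[of 0]
    proof eventually_elim
      case (elim n)
      have "(2 / ln 2) ^ j * (real n * ln 2) ^ j = (2 * real n) ^ j"
        unfolding power_mult_distrib[symmetric] by simp
      moreover have "exp (real n * ln 2) = 2 ^ n"
        using exp_of_nat_mult[of n "ln 2 :: real"] by simp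
      moreover have "(real n + 1) ^ j \<le> (2 * real n) ^ j"
        using elim by (intro power_mono) auto
      ultimately show ?case
        unfolding times_divide_eq_right by (simp only:) (rule divide_right_mono, auto)
    qed
  qed simp
qed

lemma negligible_hiding_error:
  assumes "0 \<le> a"
  shows "negligible (\<lambda>n. a * hiding_error n (c * Suc n ^ c))"
  unfolding negligible_def
proof
  fix k :: nat
  \<comment> \<open>The 18 is the 9 of \<open>hiding_error\<close> doubled, because
    \<open>2 ^ n - 1 \<ge> 2 ^ n / 2\<close> for positive \<open>n\<close>.\<close>
  define A where "A = a * (18 * (real c + 1) ^ 2)"
  have "(\<lambda>n. A * ((real n + 1) ^ (2 * c + k) / 2 ^ n)) \<longlonglongrightarrow> A * 0"
    by (intro tendsto_mult tendsto_const power_over_two_power_tendsto_0)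
  then have "\<forall>\<^sub>F n in sequentially. A * ((real n + 1) ^ (2 * c + k) / 2 ^ n) < 1"
    by (rule order_tendstoD) simp
  with eventually_gt_at_top[of 0]
  show "\<forall>\<^sub>F n in sequentially. a * hiding_error n (c * Suc n ^ c) < 1 / real n ^ k"
  proof eventually_elim
    case (elim n)
    let ?x = "real n + 1"
    have "1 \<le> ?x ^ c" by (intro one_le_power) simp
    then have "(real (c * Suc n ^ c) + 1) ^ 2 \<le> ((real c + 1) * ?x ^ c) ^ 2"
      by (intro power_mono) (auto simp: algebra_simps)
    also have "\<dots> = (real c + 1) ^ 2 * ?x ^ (2 * c)"
      by (simp add: power_mult_distrib power_mult[symmetric] mult.commute)
    finally have num: "9 * (real (c * Suc n ^ c) + 1) ^ 2 \<le> 9 * ((real c + 1) ^ 2 * ?x ^ (2 * c))" by simp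
    have "(2::real) ^ 1 \<le> 2 ^ n" using elim(1) by (intro power_increasing) auto
    then have den: "(2::real) ^ n / 2 \<le> 2 ^ n - 1" by simp
    have "hiding_error n (c * Suc n ^ c) \<le> 9 * ((real c + 1) ^ 2 * ?x ^ (2 * c)) / (2 ^ n / 2)"
      unfolding hiding_error_def using num den by (intro frac_le) auto
    then have "a * hiding_error n (c * Suc n ^ c) \<le> a * (9 * ((real c + 1) ^ 2 * ?x ^ (2 * c)) / (2 ^ n / 2))"
      using assms by (rule mult_left_mono)
    also have "\<dots> = A * (?x ^ (2 * c) / 2 ^ n)"
      by (simp add: A_def)
    finally have le: "a * hiding_error n (c * Suc n ^ c) \<le> A * (?x ^ (2 * c) / 2 ^ n)" .
    have "a * hiding_error n (c * Suc n ^ c) * real n ^ k \<le> A * (?x ^ (2 * c) / 2 ^ n) * ?x ^ k"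
      by (rule mult_mono[OF le power_mono]) (use assms in \<open>auto simp: A_def\<close>)
    also have "\<dots> = A * (?x ^ (2 * c + k) / 2 ^ n)"
      by (simp add: power_add)
    also have "\<dots> < 1" by (rule elim(2))
    finally show ?case
      using elim(1) by (simp add: pos_less_divide_eq)
  qed
qed

theorem mainTheorem2:
  fixes d :: nat and C :: "nat \<Rightarrow> qccirc"
  assumes "d \<ge> 1"
    and "is_QC d C"
  shows "negligible (\<lambda>n. success_prob n d (C n))"
proof -
  obtain c :: nat where c: "\<And>n. length (steps (C n)) = d \<and>
     (\<forall>st\<in>set (steps (C n)). step_ok n d (nq (C n)) st \<and> csize (cc st) \<le> c * Suc n ^ c) \<and>
     csize (final (C n)) \<le> c * Suc n ^ c \<and> nq (C n) \<le> c * Suc n ^ c"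
    using assms(2) unfolding is_QC_def by blast
  \<comment> \<open>At \<open>n = 0\<close> the denominator \<open>2 ^ n - 1\<close> vanishes;
    negligibility concerns large \<open>n\<close> only.\<close>
  have "success_prob n d (C n) \<le> 2 ^ Suc d * real (Suc d) * hiding_error n (c * Suc n ^ c)" if "n \<ge> 1" for n
    using that c[of n] by (intro success_prob_le) auto
  then have le: "\<forall>\<^sub>F n in sequentially. success_prob n d (C n) \<le> 2 ^ Suc d * real (Suc d) * hiding_error n (c * Suc n ^ c)"
    by (auto simp: eventually_sequentially)
  have "\<forall>\<^sub>F n in sequentially. success_prob n d (C n) < 1 / real n ^ k" for k
  proof -
    have "\<forall>\<^sub>F n in sequentially. 2 ^ Suc d * real (Suc d) * hiding_error n (c * Suc n ^ c) < 1 / real n ^ k"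
      using negligible_hiding_error[of "2 ^ Suc d * real (Suc d)" c] unfolding negligible_def by simp
    with le show ?thesis by eventually_elim (rule le_less_trans)
  qed
  then show ?thesis unfolding negligible_def by blast
qed

end
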